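(* For each $m\ge 1$ let $X_1,\dots,X_m$ be i.i.d. observations from the two-groups mixture $(1-p)N(0,1)+pN(0,1+\psi^2)$ with latent indicators $\nu_1,\dots,\nu_m$, where $p=p_m\in(0,1)$ and $\psi^2=\psi_m^2>0$ satisfy, as $m\to\infty$: $p\to0$; $\psi^2\to\infty$; $v:=\psi^2\big(\frac{1-p}{p}\big)^2\to\infty$; and $\frac{\log v}{\psi^2}\to C$ for some $C\in(0,\infty)$. Suppose moreover that $p\propto m^{-\epsilon}$ for some $0<\epsilon<1$. Consider testing $H_{0i}:\nu_i=0$ against $H_{1i}:\nu_i=1$ simultaneously for $i=1,\dots,m$ by the empirical Bayes rule that rejects $H_{0i}$ if and only if $1-E(\kappa_i\mid X_i,\widehat\tau)>\frac12$, where the posterior mean is computed under the one-group prior with mixing density $\pi(t)=Kt^{-a-1}L(t)$, $t>0$, and $\widehat\tau$ is the estimator given in the context. Assume that either (I) $\frac12<a<1$, or (II) $a=\frac12$ and $L(t)/\sqrt{\log t}\to0$ as $t\to\infty$. Then the Bayes risk $R^{EB}_{OG}$ of this rule satisfies $$R^{EB}_{OG}\ \le\ mp\Big[2\Phi\Big(\sqrt{\tfrac{2aC}{\eta(1-\delta)}}\Big)-1\Big](1+o(1))\quad\text{as } m\to\infty,$$ for every fixed $\eta\in(0,\frac12)$ and $\delta\in(0,1)$, where the $o(1)$ term tends to zero as $m\to\infty$ and depends on the choice of $\eta$ and $\delta$.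
   Context: $\Phi$ is the standard normal distribution function. Two-groups model (data-generating law): for each $m$, $\nu_1,\dots,\nu_m$ are i.i.d. Bernoulli$(p)$, and the pairs $(\nu_i,X_i)$ are independent with $X_i\mid\nu_i=0\sim N(0,1)$ and $X_i\mid\nu_i=1\sim N(0,1+\psi^2)$. "$H_{0i}$ is true" means $\nu_i=0$ and "$H_{1i}$ is true" means $\nu_i=1$. The subscript $m$ is dropped from $p_m,\psi_m$. $p\propto m^{-\epsilon}$ means $p_m=c\,m^{-\epsilon}$ with a constant $c>0$ not depending on $m$. One-group prior (used only to define the rule): $a>0$ is a real number; $L:(0,\infty)\to(0,\infty)$ is measurable, non-constant and slowly varying, i.e. for every fixed $\alpha>0$, $L(\alpha x)/L(x)\to1$ as $x\to\infty$; and $K\in(0,\infty)$ is such that $\pi(t)=Kt^{-a-1}L(t)$ is a probability density on $(0,\infty)$. For given $\tau>0$: $\lambda_i^2$ are independent with density $\pi$, $\mu_i\mid\lambda_i^2,\tau\sim N(0,\lambda_i^2\tau^2)$ independently, $X_i\mid\mu_i\sim N(\mu_i,1)$ independently, and $\kappa_i=1/(1+\lambda_i^2\tau^2)$. Under this model the posterior density of $\kappa_i$ given $(X_i,\tau)$ is proportional to $\kappa^{a+\frac12-1}(1-\kappa)^{-a-1}L\big(\frac1{\tau^2}(\frac1\kappa-1)\big)e^{-\kappa X_i^2/2}$ on $(0,1)$, and $E(\kappa_i\mid X_i,\tau)$ is the mean of this density. Empirical Bayes estimator: $\widehat\tau=\max\big\{\frac1m,\ \frac1{c_2m}\sum_{j=1}^m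 1\{|X_j|>\sqrt{c_1\log m}\}\big\}$, where $c_1\ge2$ and $c_2\ge1$ are predetermined finite constants. $E(\kappa_i\mid X_i,\widehat\tau)$ denotes the function $E(\kappa_i\mid X_i,\tau)$ evaluated at $\tau=\widehat\tau$. Bayes risk: for a multiple testing rule, let $t_{1i}=\Pr(\text{reject }H_{0i}\mid\nu_i=0)$ and $t_{2i}=\Pr(\text{do not reject }H_{0i}\mid\nu_i=1)$, with probabilities under the two-groups model. The Bayes risk is $R=\sum_{i=1}^m\{(1-p)t_{1i}+pt_{2i}\}$. *)

theory Defs
  imports "HOL-Probability.Probability"
begin

definition std_normal_cdf :: "real \<Rightarrow> real" ("\<Phi>") where
  "\<Phi> = cdf std_normal_distribution"

(* N(0, s), parametrised by the variance s (normal_density takes the standard deviation). *)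
definition centred_normal :: "real \<Rightarrow> real measure" where
  "centred_normal s = density lborel (\<lambda>x. ennreal (normal_density 0 (sqrt s) x))"

(* The data-generating law for one sample size m; "nu i" encodes nu_i = 1, that is, "H_1i is true".
   Only the observations with index in {1..m} are constrained. *)
locale two_groups = prob_space M for M :: "'a measure" +
  fixes m :: nat and p \<psi> :: real
    and \<nu> :: "nat \<Rightarrow> 'a \<Rightarrow> bool" and X :: "nat \<Rightarrow> 'a \<Rightarrow> real"
  assumes indep_pairs:
      "indep_vars (\<lambda>_. count_space UNIV \<Otimes>\<^sub>M borel) (\<lambda>i \<omega>. (\<nu> i \<omega>, X i \<omega>)) {1..m}"
    and signal_law:
      "\<And>i. i \<in> {1..m} \<Longrightarrow> distr M (count_space UNIV) (\<nu> i) = measure_pmf (bernoulli_pmf p)"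
    and null_law:
      "\<And>i A. \<lbrakk>i \<in> {1..m}; A \<in> sets borel\<rbrakk> \<Longrightarrow>
         \<P>(\<omega> in M. X i \<omega> \<in> A \<bar> \<not> \<nu> i \<omega>) = measure (centred_normal 1) A"
    and alternative_law:
      "\<And>i A. \<lbrakk>i \<in> {1..m}; A \<in> sets borel\<rbrakk> \<Longrightarrow>
         \<P>(\<omega> in M. X i \<omega> \<in> A \<bar> \<nu> i \<omega>) = measure (centred_normal (1 + \<psi>\<^sup>2)) A"

definition slowly_varying :: "(real \<Rightarrow> real) \<Rightarrow> bool" where
  "slowly_varying L \<longleftrightarrow> (\<forall>\<alpha>>0. ((\<lambda>x. L (\<alpha> * x) / L x) \<longlongrightarrow> 1) at_top)"

definition mixing_density :: "real \<Rightarrow> real \<Rightarrow> (real \<Rightarrow> real) \<Rightarrow> real \<Rightarrow> real" where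
  "mixing_density a K L t = K * t powr (- a - 1) * L t"

(* L is a function on (0, infinity); its values elsewhere are irrelevant. *)
locale one_group_prior =
  fixes a K :: real and L :: "real \<Rightarrow> real"
  assumes a_pos: "a > 0"
    and K_pos: "K > 0"
    and L_pos: "\<And>t. t > 0 \<Longrightarrow> L t > 0"
    and L_measurable: "L \<in> borel_measurable (restrict_space borel {0<..})"
    and L_nonconstant: "\<not> L constant_on {0<..}"
    and L_slowly_varying: "slowly_varying L"
    and prior_density: "(\<integral>\<^sup>+t\<in>{0<..}. ennreal (mixing_density a K L t) \<partial>lborel) = 1"

(* Unnormalised posterior density of the shrinkage coefficient kappa = 1 / (1 + lambda^2 tau^2)
   given X = x and tau, when lambda^2 has density mixing_density a K L, mu | lambda^2 is
   N(0, lambda^2 tau^2) and X | mu is N(mu, 1). Integrating out mu, X | kappa is N(0, 1/kappa),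
   which contributes kappa^(1/2) exp (- kappa x^2 / 2); the prior of kappa is the image of the
   mixing density. The constant K and a power of tau cancel in the normalisation. *)
definition kappa_kernel :: "real \<Rightarrow> (real \<Rightarrow> real) \<Rightarrow> real \<Rightarrow> real \<Rightarrow> real \<Rightarrow> real" where
  "kappa_kernel a L \<tau> x \<kappa> =
     \<kappa> powr (a + 1/2 - 1) * (1 - \<kappa>) powr (- a - 1) * L (1 / \<tau>\<^sup>2 * (1 / \<kappa> - 1)) * exp (- \<kappa> * x\<^sup>2 / 2)"

definition kappa_posterior_density ::
    "real \<Rightarrow> (real \<Rightarrow> real) \<Rightarrow> real \<Rightarrow> real \<Rightarrow> real \<Rightarrow> real" where
  "kappa_posterior_density a L \<tau> x \<kappa> =
     kappa_kernel a L \<tau> x \<kappa> / (LBINT u:{0<..<1}. kappa_kernel a L \<tau> x u)"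

definition kappa_posterior_mean :: "real \<Rightarrow> (real \<Rightarrow> real) \<Rightarrow> real \<Rightarrow> real \<Rightarrow> real" where
  "kappa_posterior_mean a L \<tau> x = (LBINT \<kappa>:{0<..<1}. \<kappa> * kappa_posterior_density a L \<tau> x \<kappa>)"

definition tau_hat :: "real \<Rightarrow> real \<Rightarrow> nat \<Rightarrow> (nat \<Rightarrow> real) \<Rightarrow> real" where
  "tau_hat c1 c2 m x =
     max (1 / real m)
         (1 / (c2 * real m) * (\<Sum>j = 1..m. of_bool (\<bar>x j\<bar> > sqrt (c1 * ln (real m)))))"

definition eb_rejects ::
    "real \<Rightarrow> (real \<Rightarrow> real) \<Rightarrow> real \<Rightarrow> real \<Rightarrow> nat \<Rightarrow> (nat \<Rightarrow> real) \<Rightarrow> nat \<Rightarrow> bool" where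
  "eb_rejects a L c1 c2 m x i \<longleftrightarrow> 1 - kappa_posterior_mean a L (tau_hat c1 c2 m x) (x i) > 1/2"

(* "rej i" is the event that H_0i is rejected. *)
definition bayes_risk ::
    "'a measure \<Rightarrow> nat \<Rightarrow> real \<Rightarrow> (nat \<Rightarrow> 'a \<Rightarrow> bool) \<Rightarrow> (nat \<Rightarrow> 'a \<Rightarrow> bool) \<Rightarrow> real" where
  "bayes_risk M m p \<nu> rej =
     (\<Sum>i = 1..m. (1 - p) * \<P>(\<omega> in M. rej i \<omega> \<bar> \<not> \<nu> i \<omega>) + p * \<P>(\<omega> in M. \<not> rej i \<omega> \<bar> \<nu> i \<omega>))"

end

theory Submission
  imports Defs "HOL-Real_Asymp.Real_Asymp"
begin

text \<open>
Let \<open>Q\<close> be the prior law of \<open>t = \<lambda>\<^sup>2\<close>. The substitution \<open>\<kappa> = 1 / (1 + t \<tau>\<^sup>2)\<close> turns the posterior mean of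
\<open>\<kappa>\<close> into \<open>E\<^sub>Q[\<kappa> w] / E\<^sub>Q[w]\<close> with \<open>w = \<surd>\<kappa> exp (-\<kappa> x\<^sup>2 / 2)\<close>. Bounding \<open>1 - \<kappa>\<close> by \<open>min (t \<tau>\<^sup>2) 1\<close>, which is
monotone in \<open>\<tau>\<close> although the posterior mean itself need not be, shows that rejection with \<open>\<tau> \<le> T\<close>
forces \<open>exp (x\<^sup>2 / 2) \<ge> const / E\<^sub>Q[min (t T\<^sup>2) 1]\<close>; under (I) or (II) such an observation has null
probability \<open>o(T)\<close>. Conversely, comparing the posterior masses of \<open>{\<kappa> > \<eta>}\<close> and \<open>{\<kappa> < \<eta> d}\<close> shows
that acceptance forces \<open>x\<^sup>2 \<le> (4 b ln (1 / \<tau>) + const) / (\<eta> (1 - d))\<close> for every \<open>b > a\<close>. Taking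
\<open>d < \<delta>\<close> and \<open>b\<close> close to \<open>a\<close> leaves room to beat the constant of the theorem, so asymptotic
equivalences for \<open>Q\<close> are never needed: slow variation enters only through \<open>L (2 t) / L t \<rightarrow> 1\<close>, iterated
over dyadic scales and integrated against \<open>Q\<close>.

By a Chernoff bound \<open>\<tau>_hat\<close> has exact order \<open>p\<close> outside an event of probability \<open>exp (- const m p) = o(p)\<close>.
This is so small that the exceptional event can be removed by a union bound, and neither the dependence
of \<open>\<tau>_hat\<close> on the observation under test nor any conditioning matters.
\<close>

section \<open>Normal distributions\<close>

lemma centred_normal_eq_distr:
  assumes "s > 0"
  shows "centred_normal s = distr std_normal_distribution borel (\<lambda>x. sqrt s * x)"
proof -
  interpret N: prob_space std_normal_distribution
    by (rule prob_space_normal_density) simp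
  have "distributed std_normal_distribution lborel (\<lambda>x. x) (normal_density 0 1)"
    by (auto simp: distributed_def distr_id2)
  from N.normal_density_affine[OF this, of "sqrt s" 0] assms
  have "distributed std_normal_distribution lborel (\<lambda>x. sqrt s * x) (normal_density 0 (sqrt s))"
    by simp
  then have "distr std_normal_distribution lborel (\<lambda>x. sqrt s * x) = centred_normal s"
    by (simp add: distributed_def centred_normal_def)
  \<comment> \<open>As a target of \<open>distr\<close>, \<open>lborel\<close> has the same sets as
    \<open>borel\<close>, so the affine rule, which speaks of \<open>lborel\<close>,
    transfers.\<close>
  then show ?thesis
    by (metis distr_cong sets_lborel)
qed

lemma centred_normal_1: "centred_normal 1 = std_normal_distribution"
  by (simp add: centred_normal_def)

lemma distr_uminus_std_normal:
  "distr std_normal_distribution borel (\<lambda>x. - x) = std_normal_distribution"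
proof -
  interpret N: prob_space std_normal_distribution
    by (rule prob_space_normal_density) simp
  have "distributed std_normal_distribution lborel (\<lambda>x. x) (normal_density 0 1)"
    by (auto simp: distributed_def distr_id2)
  from N.normal_density_affine[OF this, of "-1" 0]
  show ?thesis
    by (simp add: distributed_def) (metis distr_cong sets_lborel)
qed

text \<open>Reflection gives both open tails the same mass, and the right one has mass 1 - \<Phi> q
  because \<open>cdf\<close> measures the closed half-line up to \<open>q\<close>.\<close>

lemma measure_std_normal_symmetric_interval:
  "measure std_normal_distribution {x. \<bar>x\<bar> \<le> q} = 2 * \<Phi> q - 1" if "q \<ge> 0"
proof -
  interpret N: prob_space std_normal_distribution
    by (rule prob_space_normal_density) simp
  have "measure std_normal_distribution {..<-q} = measure (distr std_normal_distribution borel (\<lambda>x. - x)) {..<-q}"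
    by (simp add: distr_uminus_std_normal)
  also have "\<dots> = measure std_normal_distribution {q<..}"
    by (subst measure_distr) (auto intro!: arg_cong[where f="measure _"])
  finally have left: "measure std_normal_distribution {..<-q} = measure std_normal_distribution {q<..}" .
  have right: "measure std_normal_distribution {q<..} = 1 - \<Phi> q"
    using N.prob_compl[of "{..q}"]
    by (simp add: std_normal_cdf_def cdf_def Compl_eq_Diff_UNIV[symmetric] flip: greaterThan_def)
  have "{x. \<bar>x\<bar> \<le> q} = UNIV - ({..<-q} \<union> {q<..})" by auto
  moreover have "measure std_normal_distribution (UNIV - ({..<-q} \<union> {q<..}))
      = 1 - measure std_normal_distribution ({..<-q} \<union> {q<..})"
    using N.prob_compl[of "{..<-q} \<union> {q<..}"] by simp
  moreover have "measure std_normal_distribution ({..<-q} \<union> {q<..})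
      = measure std_normal_distribution {..<-q} + measure std_normal_distribution {q<..}"
    using that by (intro N.finite_measure_Union) auto
  ultimately show ?thesis using left right by simp
qed

text \<open>On the tail 1 \<le> x / \<theta>, and x times the normal density integrates to the
  density at \<theta>. The factor 1 / \<theta> is kept: for \<theta> of order sqrt (ln s) it
  supplies the logarithmic factor that the boundary case a = 1/2 requires.\<close>

lemma measure_std_normal_tail_le:
  fixes \<theta> :: real
  assumes "\<theta> > 0"
  shows "measure std_normal_distribution {x. \<theta> \<le> \<bar>x\<bar>} \<le> exp (- \<theta>\<^sup>2 / 2) / \<theta>"
proof -
  interpret N: prob_space std_normal_distribution
    by (rule prob_space_normal_density) simp
  have "measure std_normal_distribution {..-\<theta>} = measure (distr std_normal_distribution borel (\<lambda>x. - x)) {..-\<theta>}"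
    by (simp add: distr_uminus_std_normal)
  also have "\<dots> = measure std_normal_distribution {\<theta>..}"
    by (subst measure_distr) (auto intro!: arg_cong[where f="measure _"])
  finally have left: "measure std_normal_distribution {..-\<theta>} = measure std_normal_distribution {\<theta>..}" .
  have "emeasure std_normal_distribution {\<theta>..}
      = (\<integral>\<^sup>+x. ennreal (std_normal_density x) * indicator {\<theta>..} x \<partial>lborel)"
    by (simp add: emeasure_density)
  also have "\<dots> \<le> (\<integral>\<^sup>+x. ennreal (x / \<theta> * std_normal_density x) * indicator {\<theta>..} x \<partial>lborel)"
  proof (intro nn_integral_mono)
    fix x :: real
    have "1 * std_normal_density x \<le> x / \<theta> * std_normal_density x" if "\<theta> \<le> x"
      using that assms by (intro mult_right_mono) (auto simp: field_simps)
    then show "ennreal (std_normal_density x) * indicator {\<theta>..} x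
        \<le> ennreal (x / \<theta> * std_normal_density x) * indicator {\<theta>..} x"
      by (auto split: split_indicator intro!: ennreal_leI)
  qed
  also have "\<dots> = ennreal (0 - (- std_normal_density \<theta> / \<theta>))"
  proof (rule nn_integral_FTC_atLeast[where F="\<lambda>x. - std_normal_density x / \<theta>"])
    fix x :: real assume "\<theta> \<le> x"
    show "((\<lambda>x. - std_normal_density x / \<theta>) has_real_derivative x / \<theta> * std_normal_density x) (at x)"
      unfolding normal_density_def using assms
      by (auto intro!: derivative_eq_intros simp: field_simps)
    show "0 \<le> x / \<theta> * std_normal_density x"
      using assms \<open>\<theta> \<le> x\<close> by simp
  next
    have "((\<lambda>x::real. - (1 / sqrt (2 * pi) * exp (- x\<^sup>2 / 2)) / \<theta>) \<longlongrightarrow> - (1 / sqrt (2 * pi) * 0) / \<theta>) at_top"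
      using assms
      apply (intro tendsto_intros filterlim_compose[OF exp_at_bot])
       apply real_asymp
      apply simp
      done
    then show "((\<lambda>x. - std_normal_density x / \<theta>) \<longlongrightarrow> 0) at_top"
      by (simp add: normal_density_def)
  qed simp
  finally have "measure std_normal_distribution {\<theta>..} \<le> std_normal_density \<theta> / \<theta>"
    using assms by (simp add: N.emeasure_eq_measure)
  moreover have "measure std_normal_distribution {x. \<theta> \<le> \<bar>x\<bar>}
     = measure std_normal_distribution {..-\<theta>} + measure std_normal_distribution {\<theta>..}"
    using assms by (subst N.finite_measure_Union[symmetric]) (auto intro!: arg_cong[where f="measure _"])
  ultimately have "measure std_normal_distribution {x. \<theta> \<le> \<bar>x\<bar>} \<le> 2 * std_normal_density \<theta> / \<theta>"
    using left by simp
  also have "\<dots> = (2 / sqrt (2 * pi)) * (exp (- \<theta>\<^sup>2 / 2) / \<theta>)"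
    by (simp add: normal_density_def)
  also have "\<dots> \<le> 1 * (exp (- \<theta>\<^sup>2 / 2) / \<theta>)"
  proof (intro mult_right_mono)
    have "2 = sqrt (2 ^ 2)" by simp
    also have "\<dots> \<le> sqrt (2 * pi)" using pi_ge_two by (intro real_sqrt_le_mono) simp
    finally show "2 / sqrt (2 * pi) \<le> 1" by simp
  qed (use assms in simp)
  finally show ?thesis by simp
qed

text \<open>The normal density vanishes nowhere, so a null set of the normal law is Lebesgue
  null.\<close>

lemma measure_std_normal_pos:
  assumes [measurable]: "S \<in> sets borel" and "emeasure lborel S \<noteq> 0"
  shows "measure std_normal_distribution S > 0"
proof -
  interpret N: prob_space std_normal_distribution
    by (rule prob_space_normal_density) simp
  have "emeasure std_normal_distribution S \<noteq> 0"
  proof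
    assume "emeasure std_normal_distribution S = 0"
    then have "AE x in lborel. x \<in> S \<longrightarrow> ennreal (std_normal_density x) = 0"
      by (subst (asm) emeasure_density) (auto simp: nn_integral_0_iff_AE elim!: eventually_mono split: split_indicator_asm)
    then have "AE x in lborel. x \<notin> S"
    proof eventually_elim
      case (elim x)
      then show ?case using normal_density_pos[of 1 0 x] by (auto simp: ennreal_eq_0_iff)
    qed
    then have "emeasure lborel S = 0"
      by (subst (asm) AE_iff_measurable[where N=S]) auto
    then show False using assms by simp
  qed
  then show ?thesis by (simp add: N.emeasure_eq_measure zero_less_measure_iff)
qed

lemma two_Phi_minus_one_pos: "2 * \<Phi> q - 1 > 0" if "q > 0"
proof -
  have "{x. \<bar>x\<bar> \<le> q} = {- q..q}" by auto
  then have "measure std_normal_distribution {x. \<bar>x\<bar> \<le> q} > 0"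
    using that by (intro measure_std_normal_pos) simp_all
  then show ?thesis using measure_std_normal_symmetric_interval[of q] that by simp
qed

lemma measure_centred_normal_interval:
  assumes "s > 0" "q \<ge> 0"
  shows "measure (centred_normal s) {x. \<bar>x\<bar> \<le> sqrt s * q} = 2 * \<Phi> q - 1"
proof -
  have "measure (centred_normal s) {x. \<bar>x\<bar> \<le> sqrt s * q}
      = measure std_normal_distribution {x. \<bar>x\<bar> \<le> q}"
    using assms unfolding centred_normal_eq_distr[OF assms(1)]
    by (subst measure_distr) (auto intro!: arg_cong[where f="measure _"] simp: abs_mult)
  then show ?thesis using measure_std_normal_symmetric_interval assms by simp
qed

section \<open>The prior law\<close>

text \<open>Repeated halving brings \<open>s\<close> into [s0, 2 * s0]. Each halving accounts for a
  factor 2 powr (- b), and on the base range the remaining power of s / s0 is at most 1 because b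
  \<ge> 0.\<close>

lemma dyadic_lower_bound:
  fixes J :: "real \<Rightarrow> real"
  assumes s0: "s0 > 0" and c: "c \<ge> 0" and b: "b \<ge> 0"
    and base: "\<And>s. \<lbrakk>s0 \<le> s; s \<le> 2 * s0\<rbrakk> \<Longrightarrow> c \<le> J s"
    and step: "\<And>s. s0 \<le> s \<Longrightarrow> 2 powr (- b) * J s \<le> J (2 * s)"
    and s: "s0 \<le> s"
  shows "c * (s / s0) powr (- b) \<le> J s"
proof -
  have *: "c * (s / s0) powr (- b) \<le> J s" if "s0 \<le> s" "s \<le> 2 ^ Suc n * s0" for n s
    using that
  proof (induction n arbitrary: s)
    case 0
    have "1 \<le> (s / s0) powr b"
      using 0 s0 b by (intro ge_one_powr_ge_zero) auto
    then have "(s / s0) powr (- b) \<le> 1"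
      by (simp add: powr_minus inverse_le_1_iff)
    then have "c * (s / s0) powr (- b) \<le> c * 1"
      using c by (intro mult_left_mono) auto
    also have "\<dots> \<le> J s" using base 0 by simp
    finally show ?case .
  next
    case (Suc n)
    show ?case
    proof (cases "s \<le> 2 ^ Suc n * s0")
      case True
      then show ?thesis using Suc by simp
    next
      case False
      have "2 * s0 \<le> 2 ^ Suc n * s0" using s0 by simp
      then have ge: "s0 \<le> s / 2" using False by simp
      have "c * (s / s0) powr (- b) = 2 powr (- b) * (c * (s / 2 / s0) powr (- b))"
        using Suc.prems s0 by (simp add: powr_divide powr_minus powr_mult field_simps)
      also have "\<dots> \<le> 2 powr (- b) * J (s / 2)"
        using Suc.IH[of "s / 2"] ge Suc.prems by (intro mult_left_mono) auto
      also have "\<dots> \<le> J s" using step[of "s / 2"] ge by simp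
      finally show ?thesis .
    qed
  qed
  obtain n where "s / s0 < 2 ^ n" using real_arch_pow[of 2 "s / s0"] by auto
  then have "s \<le> 2 ^ n * s0" using s0 by (simp add: field_simps)
  also have "\<dots> \<le> 2 ^ Suc n * s0" using s0 by simp
  finally show ?thesis using * s by blast
qed

context one_group_prior
begin

text \<open>Extension by zero: \<open>L\<close> is unconstrained off the positive half-line, whereas
  this density is Borel on the whole line.\<close>

definition prior_pdf :: "real \<Rightarrow> real" where
  "prior_pdf t = (if 0 < t then mixing_density a K L t else 0)"

definition prior :: "real measure" where
  "prior = density lborel (\<lambda>t. ennreal (prior_pdf t))"

lemma prior_pdf_measurable [measurable]: "prior_pdf \<in> borel_measurable borel"
proof -
  have "(\<lambda>t. indicator {0<..} t *\<^sub>R L t) \<in> borel_measurable borel"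
    using L_measurable by (subst borel_measurable_restrict_space_iff[symmetric]) auto
  then have "(\<lambda>t. K * t powr (- a - 1) * (indicator {0<..} t *\<^sub>R L t)) \<in> borel_measurable borel"
    by measurable
  also have "(\<lambda>t. K * t powr (- a - 1) * (indicator {0<..} t *\<^sub>R L t)) = prior_pdf"
    by (auto simp: prior_pdf_def mixing_density_def fun_eq_iff)
  finally show ?thesis .
qed

lemma prior_pdf_pos: "t > 0 \<Longrightarrow> prior_pdf t > 0"
  using L_pos K_pos by (simp add: prior_pdf_def mixing_density_def)

lemma prior_pdf_nonneg: "prior_pdf t \<ge> 0"
  using prior_pdf_pos[of t] by (cases "t > 0") (auto simp: prior_pdf_def)

lemma space_prior [simp]: "space prior = UNIV"
  and sets_prior [measurable_cong, simp]: "sets prior = sets borel"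
  by (simp_all add: prior_def)

lemma nn_integral_prior:
  "f \<in> borel_measurable borel \<Longrightarrow> (\<integral>\<^sup>+t. f t \<partial>prior) = (\<integral>\<^sup>+t. ennreal (prior_pdf t) * f t \<partial>lborel)"
  unfolding prior_def by (subst nn_integral_density) auto

lemma prob_space_prior: "prob_space prior"
proof
  have "emeasure prior (space prior) = (\<integral>\<^sup>+t. ennreal (prior_pdf t) \<partial>lborel)"
    by (simp add: prior_def emeasure_density)
  also have "\<dots> = (\<integral>\<^sup>+t\<in>{0<..}. ennreal (mixing_density a K L t) \<partial>lborel)"
    by (intro nn_integral_cong) (auto simp: prior_pdf_def)
  finally show "emeasure prior (space prior) = 1" using prior_density by simp
qed

sublocale Q: prob_space prior by (rule prob_space_prior)

lemma AE_prior_pos: "AE t in prior. 0 < t"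
  unfolding prior_def by (subst AE_density, measurable) (auto simp: prior_pdf_def intro!: AE_I2)

lemma prior_interval_pos:
  assumes "0 \<le> u" "u < v"
  shows "Q.prob {u..v} > 0"
proof -
  have "emeasure prior {u..v} \<noteq> 0"
  proof
    assume "emeasure prior {u..v} = 0"
    then have "AE t in lborel. t \<in> {u..v} \<longrightarrow> ennreal (prior_pdf t) = 0"
      unfolding prior_def by (subst (asm) emeasure_density)
        (auto simp: nn_integral_0_iff_AE elim!: eventually_mono split: split_indicator_asm)
    \<comment> \<open>The left end may be 0, where the density is zero; hence the half-open
      interval.\<close>
    then have "AE t in lborel. t \<notin> {u<..v}"
    proof eventually_elim
      case (elim t)
      then show ?case using prior_pdf_pos[of t] assms by (auto simp: ennreal_eq_0_iff)
    qed
    then have "emeasure lborel {u<..v} = 0"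
      by (subst (asm) AE_iff_measurable[where N="{u<..v}"]) auto
    then show False using assms by simp
  qed
  then show ?thesis by (simp add: Q.emeasure_eq_measure zero_less_measure_iff)
qed

text \<open>Slow variation enters here and nowhere else. The factor 2 is the Jacobian of doubling;
  it turns the exponent - a - 1 of the density into the exponent - a of the tail.\<close>

lemma prior_pdf_doubling: "((\<lambda>t. 2 * prior_pdf (2 * t) / prior_pdf t) \<longlongrightarrow> 2 powr (- a)) at_top"
proof -
  have "((\<lambda>t. 2 powr (- a) * (L (2 * t) / L t)) \<longlongrightarrow> 2 powr (- a) * 1) at_top"
    using L_slowly_varying unfolding slowly_varying_def by (intro tendsto_intros) auto
  moreover have "\<forall>\<^sub>F t in at_top. 2 powr (- a) * (L (2 * t) / L t) = 2 * prior_pdf (2 * t) / prior_pdf t"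
    using eventually_gt_at_top[of 0]
  proof eventually_elim
    case (elim t)
    have "2 powr (-a-1) * 2 = (2::real) powr (-a)"
      by (simp add: powr_diff)
    with elim show ?case using K_pos L_pos[of t]
      by (simp add: prior_pdf_def mixing_density_def powr_mult field_simps)
  qed
  ultimately show ?thesis by (simp add: filterlim_cong)
qed

lemma nn_integral_prior_double:
  assumes [measurable]: "f \<in> borel_measurable borel"
  shows "(\<integral>\<^sup>+t. f t \<partial>prior) = (\<integral>\<^sup>+t. ennreal (2 * prior_pdf (2 * t)) * f (2 * t) \<partial>lborel)"
  by (subst nn_integral_prior, measurable, subst nn_integral_real_affine[where c=2 and t=0])
     (auto simp: nn_integral_cmult[symmetric] ennreal_mult' mult.assoc)

lemma prior_double_le:
  assumes "b < a"
  obtains t0 where "t0 > 0" "\<And>f. \<lbrakk>f \<in> borel_measurable borel; \<And>t. t < 2 * t0 \<Longrightarrow> f t = 0\<rbrakk> \<Longrightarrow>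
     (\<integral>\<^sup>+t. f t \<partial>prior) \<le> ennreal (2 powr (- b)) * (\<integral>\<^sup>+t. f (2 * t) \<partial>prior)"
proof -
  have "\<forall>\<^sub>F t in at_top. 2 * prior_pdf (2 * t) / prior_pdf t < 2 powr (- b)"
    using assms by (intro order_tendstoD(2)[OF prior_pdf_doubling]) simp
  then obtain t1 where t1: "\<And>t. t \<ge> t1 \<Longrightarrow> 2 * prior_pdf (2 * t) / prior_pdf t < 2 powr (- b)"
    by (auto simp: eventually_at_top_linorder)
  define t0 where "t0 = max 1 t1"
  have *: "2 * prior_pdf (2 * t) \<le> 2 powr (- b) * prior_pdf t" if "t \<ge> t0" for t
    using t1[of t] that prior_pdf_pos[of t] by (simp add: t0_def field_simps)
  show ?thesis
  proof (rule that[of t0])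
    fix f :: "real \<Rightarrow> ennreal"
    assume [measurable]: "f \<in> borel_measurable borel" and 0: "\<And>t. t < 2 * t0 \<Longrightarrow> f t = 0"
    have "(\<integral>\<^sup>+t. f t \<partial>prior) = (\<integral>\<^sup>+t. ennreal (2 * prior_pdf (2 * t)) * f (2 * t) \<partial>lborel)"
      by (rule nn_integral_prior_double) measurable
    also have "\<dots> \<le> (\<integral>\<^sup>+t. ennreal (2 powr (- b) * prior_pdf t) * f (2 * t) \<partial>lborel)"
    proof (intro nn_integral_mono)
      fix t
      show "ennreal (2 * prior_pdf (2 * t)) * f (2 * t) \<le> ennreal (2 powr (- b) * prior_pdf t) * f (2 * t)"
        using *[of t] 0[of "2 * t"]
        by (cases "t \<ge> t0") (auto intro!: mult_right_mono ennreal_leI)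
    qed
    also have "\<dots> = ennreal (2 powr (- b)) * (\<integral>\<^sup>+t. f (2 * t) \<partial>prior)"
      by (simp add: nn_integral_prior nn_integral_cmult[symmetric] ennreal_mult' mult.assoc)
    finally show "(\<integral>\<^sup>+t. f t \<partial>prior) \<le> ennreal (2 powr (- b)) * (\<integral>\<^sup>+t. f (2 * t) \<partial>prior)" .
  qed (simp add: t0_def)
qed

text \<open>The reverse domination, for b > a: interval masses decay no faster than by 2 powr (- b)
  per doubling.\<close>

lemma prior_double_ge:
  assumes "a < b"
  obtains t0 where "t0 > 0" "\<And>u v. t0 \<le> u \<Longrightarrow> 2 powr (- b) * Q.prob {u..v} \<le> Q.prob {2 * u..2 * v}"
proof -
  have "\<forall>\<^sub>F t in at_top. 2 * prior_pdf (2 * t) / prior_pdf t > 2 powr (- b)"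
    using assms by (intro order_tendstoD(1)[OF prior_pdf_doubling]) simp
  then obtain t1 where t1: "\<And>t. t \<ge> t1 \<Longrightarrow> 2 * prior_pdf (2 * t) / prior_pdf t > 2 powr (- b)"
    by (auto simp: eventually_at_top_linorder)
  define t0 where "t0 = max 1 t1"
  have *: "2 powr (- b) * prior_pdf t \<le> 2 * prior_pdf (2 * t)" if "t \<ge> t0" for t
    using t1[of t] that prior_pdf_pos[of t] by (simp add: t0_def field_simps)
  show ?thesis
  proof (rule that[of t0])
    fix u v assume u: "t0 \<le> u"
    have "ennreal (2 powr (- b)) * emeasure prior {u..v}
        = ennreal (2 powr (- b)) * (\<integral>\<^sup>+t. indicator {u..v} t \<partial>prior)"
      by simp
    also have "\<dots> = (\<integral>\<^sup>+t. ennreal (2 powr (- b) * prior_pdf t) * indicator {u..v} t \<partial>lborel)"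
      by (subst nn_integral_prior) (auto simp: nn_integral_cmult[symmetric] ennreal_mult' mult.assoc)
    also have "\<dots> \<le> (\<integral>\<^sup>+t. ennreal (2 * prior_pdf (2 * t)) * indicator {2 * u..2 * v} (2 * t) \<partial>lborel)"
      using * u by (intro nn_integral_mono) (auto split: split_indicator intro!: ennreal_leI)
    also have "\<dots> = (\<integral>\<^sup>+t. indicator {2 * u..2 * v} t \<partial>prior)"
      by (rule nn_integral_prior_double[symmetric]) measurable
    also have "\<dots> = emeasure prior {2 * u..2 * v}" by simp
    finally show "2 powr (- b) * Q.prob {u..v} \<le> Q.prob {2 * u..2 * v}"
      by (simp add: Q.emeasure_eq_measure ennreal_mult'[symmetric])
  qed (simp add: t0_def)
qed

text \<open>For s = 1 / \<tau>^2 this is the prior mass of a region where t * \<tau>^2 is of order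
  1. The doubling inequality carries it from a base range of \<open>s\<close> to all larger
  ones.\<close>

lemma prior_interval_lower_bound:
  assumes "a < b" "A > 0"
  obtains c s0 where "c > 0" "s0 \<ge> 1" "\<And>s. s \<ge> s0 \<Longrightarrow> c * s powr (- b) \<le> Q.prob {A * s..3 * A * s}"
proof -
  obtain t0 where t0: "t0 > 0" "\<And>u v. t0 \<le> u \<Longrightarrow> 2 powr (- b) * Q.prob {u..v} \<le> Q.prob {2 * u..2 * v}"
    using prior_double_ge[OF assms(1)] by blast
  define s0 where "s0 = max 1 (t0 / A)"
  have s0: "s0 \<ge> 1" "t0 \<le> A * s0" using assms by (auto simp: s0_def max_def field_simps)
  \<comment> \<open>The end points of {A * s..3 * A * s} have ratio 3, more than 2, so for all s in
    [s0, 2 * s0] these intervals share one interval of positive mass.\<close>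
  define c where "c = Q.prob {2 * A * s0..3 * A * s0}"
  have c: "c > 0" unfolding c_def using assms s0 by (intro prior_interval_pos) auto
  show ?thesis
  proof (rule that[of "c * s0 powr b" s0])
    fix s assume s: "s \<ge> s0"
    have "c * (s / s0) powr (- b) \<le> Q.prob {A * s..3 * A * s}"
    proof (rule dyadic_lower_bound[where J="\<lambda>s. Q.prob {A * s..3 * A * s}"])
      fix s assume "s0 \<le> s" "s \<le> 2 * s0"
      then show "c \<le> Q.prob {A * s..3 * A * s}"
        unfolding c_def using assms by (intro Q.finite_measure_mono) auto
    next
      fix s assume "s0 \<le> s"
      then have "t0 \<le> A * s" using s0(2) assms by (meson mult_left_mono less_imp_le order_trans)
      from t0(2)[OF this, of "3 * A * s"]
      show "2 powr (- b) * Q.prob {A * s..3 * A * s} \<le> Q.prob {A * (2 * s)..3 * A * (2 * s)}"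
        by (simp add: ac_simps)
    qed (use s0 s c assms a_pos in auto)
    also have "c * (s / s0) powr (- b) = c * s0 powr b * s powr (- b)"
      using s s0 by (simp add: powr_divide powr_minus field_simps)
    finally show "c * s0 powr b * s powr (- b) \<le> Q.prob {A * s..3 * A * s}" .
  qed (use c s0 in auto)
qed

text \<open>Doubling multiplies t powr b' by 2 powr b' and the prior weight by at most 2 powr (- b).
  With b' < b < a the dyadic contributions are dominated by a geometric series.\<close>

lemma prior_moment_finite:
  assumes "0 \<le> b'" "b' < a"
  shows "(\<integral>\<^sup>+t. ennreal (t powr b') \<partial>prior) < \<infinity>"
proof -
  define b where "b = (a + b') / 2"
  have b: "b < a" "b' < b" using assms by (auto simp: b_def)
  obtain t0 where t0: "t0 > 0" "\<And>f. \<lbrakk>f \<in> borel_measurable borel; \<And>t. t < 2 * t0 \<Longrightarrow> f t = 0\<rbrakk> \<Longrightarrow>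
     (\<integral>\<^sup>+t. f t \<partial>prior) \<le> ennreal (2 powr (- b)) * (\<integral>\<^sup>+t. f (2 * t) \<partial>prior)"
    using prior_double_le[OF b(1)] by blast
  define r :: real where "r = 2 powr (b' - b)"
  have r: "0 < r" "r < 1" using b powr_less_mono[of "b' - b" 0 2] by (auto simp: r_def)
  \<comment> \<open>The fixed point of y = (2 * t0) powr b' + r * y, hence a bound that the
    induction on the truncation level preserves.\<close>
  define A where "A = (2 * t0) powr b' / (1 - r)"
  have A: "(2 * t0) powr b' + r * A = A" "A \<ge> 0"
    using r by (auto simp: A_def divide_simps) (auto simp: algebra_simps)
  \<comment> \<open>Truncation at 2 ^ n * t0 starts the induction from a finite integral; for the
    full integral the recursive inequality would still allow the value infinity.\<close>
  define g where "g n t = ennreal (t powr b') * indicator {t0..2 ^ n * t0} t" for n t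
  have [measurable]: "g n \<in> borel_measurable borel" for n unfolding g_def by measurable
  have low: "(\<integral>\<^sup>+t. ennreal (t powr b') * indicator {0<..2 * t0} t \<partial>prior) \<le> ennreal ((2 * t0) powr b')"
  proof -
    have "(\<integral>\<^sup>+t. ennreal (t powr b') * indicator {0<..2 * t0} t \<partial>prior) \<le> (\<integral>\<^sup>+t. ennreal ((2 * t0) powr b') \<partial>prior)"
      using assms by (intro nn_integral_mono) (auto split: split_indicator intro!: ennreal_leI powr_mono2)
    then show ?thesis using Q.emeasure_space_1 by simp
  qed
  have G: "(\<integral>\<^sup>+t. g n t \<partial>prior) \<le> ennreal A" for n
  proof (induction n)
    case 0
    have "(\<integral>\<^sup>+t. g 0 t \<partial>prior) \<le> (\<integral>\<^sup>+t. ennreal (t powr b') * indicator {0<..2 * t0} t \<partial>prior)"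
      using t0 by (intro nn_integral_mono) (auto simp: g_def split: split_indicator)
    also have "\<dots> \<le> ennreal ((2 * t0) powr b')" by (rule low)
    also have "\<dots> \<le> ennreal A" using A r by (intro ennreal_leI) (metis le_add_same_cancel1 mult_nonneg_nonneg less_imp_le)
    finally show ?case .
  next
    case (Suc n)
    define h where "h t = ennreal (t powr b') * indicator {2 * t0..2 ^ Suc n * t0} t" for t
    have [measurable]: "h \<in> borel_measurable borel" unfolding h_def by measurable
    have "(\<integral>\<^sup>+t. g (Suc n) t \<partial>prior) \<le> (\<integral>\<^sup>+t. ennreal (t powr b') * indicator {0<..2 * t0} t + h t \<partial>prior)"
      using t0 by (intro nn_integral_mono) (auto simp: g_def h_def split: split_indicator)
    also have "\<dots> = (\<integral>\<^sup>+t. ennreal (t powr b') * indicator {0<..2 * t0} t \<partial>prior) + (\<integral>\<^sup>+t. h t \<partial>prior)"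
      by (rule nn_integral_add) measurable
    also have "(\<integral>\<^sup>+t. h t \<partial>prior) \<le> ennreal (2 powr (- b)) * (\<integral>\<^sup>+t. h (2 * t) \<partial>prior)"
      by (rule t0(2)) (auto simp: h_def)
    also have "(\<integral>\<^sup>+t. h (2 * t) \<partial>prior) = (\<integral>\<^sup>+t. ennreal (2 powr b') * g n t \<partial>prior)"
      using t0 by (intro nn_integral_cong)
        (auto simp: h_def g_def powr_mult ennreal_mult split: split_indicator)
    also have "\<dots> = ennreal (2 powr b') * (\<integral>\<^sup>+t. g n t \<partial>prior)"
      by (rule nn_integral_cmult) measurable
    also have "ennreal (2 powr (- b)) * (ennreal (2 powr b') * (\<integral>\<^sup>+t. g n t \<partial>prior)) = ennreal r * (\<integral>\<^sup>+t. g n t \<partial>prior)"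
      by (simp add: r_def mult.assoc[symmetric] ennreal_mult'[symmetric] powr_add[symmetric])
    also have "\<dots> \<le> ennreal r * ennreal A" by (intro mult_left_mono Suc) auto
    finally have "(\<integral>\<^sup>+t. g (Suc n) t \<partial>prior) \<le> ennreal ((2 * t0) powr b') + ennreal r * ennreal A"
      using low by (meson add_mono order_trans order_refl)
    also have "\<dots> = ennreal A" using A r by (simp add: ennreal_mult[symmetric] flip: ennreal_plus)
    finally show ?case .
  qed
  have sup: "(SUP n. g n t) = ennreal (t powr b') * indicator {t0..} t" for t
  proof (rule SUP_eqI)
    fix y assume y: "\<And>n. n \<in> UNIV \<Longrightarrow> g n t \<le> y"
    obtain n where "t / t0 < 2 ^ n" using real_arch_pow[of 2 "t / t0"] by auto
    then have "t \<le> 2 ^ n * t0" using t0 by (simp add: field_simps)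
    then show "ennreal (t powr b') * indicator {t0..} t \<le> y"
      using y[of n] by (auto simp: g_def split: split_indicator_asm split_indicator)
  qed (auto simp: g_def split: split_indicator)
  have inc: "incseq g"
  proof (intro monoI le_funI)
    fix n k :: nat and t assume "n \<le> k"
    then have "2 ^ n * t0 \<le> 2 ^ k * t0" using t0 by simp
    then show "g n t \<le> g k t" by (auto simp: g_def split: split_indicator)
  qed
  have "(\<integral>\<^sup>+t. ennreal (t powr b') * indicator {t0..} t \<partial>prior) = (SUP n. (\<integral>\<^sup>+t. g n t \<partial>prior))"
    unfolding sup[symmetric] by (rule nn_integral_monotone_convergence_SUP[OF inc]) measurable
  also have "\<dots> \<le> ennreal A" using G by (intro SUP_least) auto
  finally have high: "(\<integral>\<^sup>+t. ennreal (t powr b') * indicator {t0..} t \<partial>prior) \<le> ennreal A" .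
  have "(\<integral>\<^sup>+t. ennreal (t powr b') \<partial>prior)
      \<le> (\<integral>\<^sup>+t. ennreal (t powr b') * indicator {0<..2 * t0} t + ennreal (t powr b') * indicator {t0..} t \<partial>prior)"
    using AE_prior_pos t0 by (intro nn_integral_mono_AE) (auto elim!: eventually_mono split: split_indicator)
  also have "\<dots> = (\<integral>\<^sup>+t. ennreal (t powr b') * indicator {0<..2 * t0} t \<partial>prior)
      + (\<integral>\<^sup>+t. ennreal (t powr b') * indicator {t0..} t \<partial>prior)"
    by (rule nn_integral_add) measurable
  also have "\<dots> \<le> ennreal ((2 * t0) powr b') + ennreal A" by (intro add_mono low high)
  also have "\<dots> < \<infinity>" by simp
  finally show ?thesis .
qed

end

section \<open>Decay of the truncated prior mean\<close>

lemma sqrt_ln_le: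
  fixes s t :: real
  assumes s: "s \<ge> exp 2" and t: "t \<ge> 1"
  shows "sqrt (ln t) \<le> sqrt (ln s) * max 1 ((t / s) powr (1/4))"
proof (cases "t \<le> s")
  case True
  have "sqrt (ln t) \<le> sqrt (ln s) * 1" using True t by simp
  also have "\<dots> \<le> sqrt (ln s) * max 1 ((t / s) powr (1/4))"
    using s exp_gt_zero[of "2::real"] True t by (intro mult_left_mono) auto
  finally show ?thesis .
next
  case False
  have s_pos: "s > 0" using s exp_gt_zero[of "2::real"] by linarith
  have ln_s: "ln s \<ge> 2" using s s_pos by (simp add: ln_ge_iff)
  \<comment> \<open>With this \<open>y\<close>, ln (t / s) = 2 * ln y \<le> 2 * (y - 1), and ln s
    \<ge> 2 absorbs the 2. The outer square root then halves the exponent to 1/4.\<close>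
  define y where "y = (t / s) powr (1/2)"
  have y: "y \<ge> 1" unfolding y_def using False s_pos by (intro ge_one_powr_ge_zero) auto
  have "ln t = ln s + ln (t / s)" using s_pos t by (simp add: ln_div)
  also have "ln (t / s) = 2 * ln y" using s_pos t by (simp add: y_def ln_powr)
  also have "\<dots> \<le> 2 * (y - 1)" using y by (intro mult_left_mono ln_le_minus_one) auto
  also have "\<dots> \<le> ln s * (y - 1)" using y ln_s by (intro mult_right_mono) auto
  finally have "ln t \<le> ln s * y" by (simp add: algebra_simps)
  then have "sqrt (ln t) \<le> sqrt (ln s) * sqrt y" by (simp flip: real_sqrt_mult)
  also have "sqrt y = (t / s) powr (1/4)" using s_pos t by (simp add: y_def powr_powr flip: powr_half_sqrt)
  also have "sqrt (ln s) * (t / s) powr (1/4) \<le> sqrt (ln s) * max 1 ((t / s) powr (1/4))"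
    using ln_s by (intro mult_left_mono) auto
  finally show ?thesis .
qed

text \<open>In case (II), \<open>u = t / s\<close> rescales a multiple of this function into a bound for \<open>min (t / s) 1\<close> times the prior density.\<close>

definition tail_profile :: "real \<Rightarrow> real" where
  "tail_profile u = (if 0 < u then min u 1 * u powr (- 3/2) * max 1 (u powr (1/4)) else 0)"

lemma tail_profile_measurable [measurable]: "tail_profile \<in> borel_measurable borel"
  unfolding tail_profile_def by measurable

text \<open>The profile is u powr (- 1/2) up to 1 and u powr (- 5/4) beyond; the exponent 1/4 that
  pays for the logarithm is small enough to keep the decay at infinity integrable.\<close>

lemma tail_profile_integral_finite: "(\<integral>\<^sup>+u. ennreal (tail_profile u) \<partial>lborel) < \<infinity>"
proof -
  have "(\<integral>\<^sup>+u. ennreal (tail_profile u) \<partial>lborel)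
      \<le> (\<integral>\<^sup>+u. ennreal (u powr (- 1/2)) * indicator {0..1} u + ennreal (u powr (- 5/4)) * indicator {1..} u \<partial>lborel)"
  proof (rule nn_integral_mono)
    fix u :: real
    consider "u \<le> 0" | "0 < u" "u \<le> 1" | "1 < u" by linarith
    then show "ennreal (tail_profile u)
        \<le> ennreal (u powr (- 1/2)) * indicator {0..1} u + ennreal (u powr (- 5/4)) * indicator {1..} u"
    proof cases
      case 2
      then have "u powr (1/4) \<le> 1" by (intro powr_le1) auto
      moreover have "u * u powr (- 3/2) = u powr (- 1/2)"
        using 2 powr_add[of u 1 "-3/2"] by simp
      ultimately have "tail_profile u = u powr (- 1/2)"
        using 2 by (simp add: tail_profile_def max_def min_def)
      then show ?thesis using 2 by (auto split: split_indicator)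
    next
      case 3
      then have "1 \<le> u powr (1/4)" by (intro ge_one_powr_ge_zero) auto
      moreover have "u powr (- 3/2) * u powr (1/4) = u powr (- 5/4)"
        using 3 by (simp flip: powr_add)
      ultimately have "tail_profile u = u powr (- 5/4)"
        using 3 by (simp add: tail_profile_def max_def min_def)
      then show ?thesis using 3 by (auto split: split_indicator)
    qed (simp add: tail_profile_def)
  qed
  also have "\<dots> = (\<integral>\<^sup>+u. ennreal (u powr (- 1/2)) * indicator {0..1} u \<partial>lborel)
      + (\<integral>\<^sup>+u. ennreal (u powr (- 5/4)) * indicator {1..} u \<partial>lborel)"
    by (rule nn_integral_add) measurable
  also have "(\<integral>\<^sup>+u. ennreal (u powr (- 1/2)) * indicator {0..1} u \<partial>lborel) = ennreal 2"
  proof -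
    have "((\<lambda>u. u powr (- 1/2)) has_integral (2::real)) {0..1}"
      using has_integral_powr_from_0[of "-1/2" 1] by simp
    then have "((\<lambda>u. if u \<in> {0..1} then u powr (- 1/2) else 0) has_integral (2::real)) UNIV"
      by (simp only: has_integral_restrict_UNIV)
    moreover have "(\<lambda>u::real. if u \<in> {0..1} then u powr (- 1/2) else 0) = (\<lambda>u. u powr (- 1/2) * indicator {0..1} u)"
      by (auto simp: fun_eq_iff)
    ultimately show ?thesis
      using nn_integral_has_integral_lborel[of "\<lambda>u. u powr (- 1/2) * indicator {0..1} u" 2]
      by (simp add: ennreal_mult'' ennreal_indicator)
  qed
  also have "(\<integral>\<^sup>+u. ennreal (u powr (- 5/4)) * indicator {1..} u \<partial>lborel) = ennreal (0 - (- 4 * 1 powr (- 1/4)))"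
  proof (rule nn_integral_FTC_atLeast[where F="\<lambda>u. - 4 * u powr (- 1/4)"])
    show "((\<lambda>u::real. - 4 * u powr (- 1/4)) \<longlongrightarrow> 0) at_top" by real_asymp
  qed (auto intro!: derivative_eq_intros)
  finally show ?thesis by (simp add: order_le_less_trans)
qed

context one_group_prior
begin

text \<open>With s = 1 / \<tau>^2 this is the prior mean of min (t * \<tau>^2) 1, the majorant of 1
  - \<kappa> that increases with \<tau>.\<close>

definition trunc_mean :: "real \<Rightarrow> real" where
  "trunc_mean s = Q.expectation (\<lambda>t. min (t / s) 1)"

lemma integrable_trunc: "s > 0 \<Longrightarrow> integrable prior (\<lambda>t. min (t / s) 1)"
  using AE_prior_pos by (intro Q.integrable_const_bound[where B=1]) (auto elim!: eventually_mono simp: min_def)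

lemma trunc_mean_nonneg: "s > 0 \<Longrightarrow> trunc_mean s \<ge> 0"
  unfolding trunc_mean_def using AE_prior_pos by (intro integral_nonneg_AE) (auto elim!: eventually_mono)

lemma ennreal_trunc_mean:
  "s > 0 \<Longrightarrow> ennreal (trunc_mean s) = (\<integral>\<^sup>+t. ennreal (min (t / s) 1) \<partial>prior)"
  unfolding trunc_mean_def using AE_prior_pos
  by (intro nn_integral_eq_integral[symmetric] integrable_trunc) (auto elim!: eventually_mono)

lemma trunc_mean_antimono: "\<lbrakk>0 < s; s \<le> s'\<rbrakk> \<Longrightarrow> trunc_mean s' \<le> trunc_mean s"
  unfolding trunc_mean_def using AE_prior_pos
  by (intro integral_mono_AE integrable_trunc) (auto elim!: eventually_mono simp: frac_le min.coboundedI1 intro!: min.mono)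

text \<open>The rate o(sqrt (ln s / s)) is what the Gaussian tail bound later converts into a null
  probability o(T) at s = 1 / T^2. For a > 1/2 a moment of order between 1/2 and a gives a smaller
  power of \<open>s\<close>. For a = 1/2 the scaling t = s * u isolates sqrt (ln s / s), and the
  hypothesis on \<open>L\<close> makes its coefficient arbitrarily small.\<close>

lemma trunc_mean_small:
  assumes "(1/2 < a \<and> a < 1) \<or> (a = 1/2 \<and> ((\<lambda>t. L t / sqrt (ln t)) \<longlongrightarrow> 0) at_top)"
  shows "((\<lambda>s. trunc_mean s * sqrt s / sqrt (ln s)) \<longlongrightarrow> 0) at_top"
proof (rule tendstoI)
  fix e :: real assume e: "e > 0"
  have nonneg: "trunc_mean s * sqrt s / sqrt (ln s) \<ge> 0" if "s \<ge> exp 2" for s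
  proof -
    have s: "s > 0" using that exp_gt_zero[of "2::real"] by linarith
    then have "ln s \<ge> 2" using that by (simp add: ln_ge_iff)
    then have "sqrt (ln s) \<ge> 0" by (intro real_sqrt_ge_zero) simp
    moreover have "0 \<le> trunc_mean s * sqrt s" using trunc_mean_nonneg[OF s] s by simp
    ultimately show ?thesis by (rule divide_nonneg_nonneg[rotated])
  qed
  have "\<forall>\<^sub>F s in at_top. trunc_mean s * sqrt s / sqrt (ln s) < e"
    using assms
  proof (elim disjE conjE)
    assume a: "1/2 < a" "a < 1"
    \<comment> \<open>b' > 1/2 makes s powr (1/2 - b') vanish, b' < a keeps the moment finite, and
      b' < 1 gives min u 1 \<le> u powr b'.\<close>
    define b' where "b' = (a + 1/2) / 2"
    have b': "1/2 < b'" "b' < a" "b' < 1" using a by (auto simp: b'_def)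
    define \<mu> where "\<mu> = enn2real (\<integral>\<^sup>+t. ennreal (t powr b') \<partial>prior)"
    have \<mu>: "ennreal \<mu> = (\<integral>\<^sup>+t. ennreal (t powr b') \<partial>prior)" "\<mu> \<ge> 0"
      using prior_moment_finite[of b'] b' by (auto simp: \<mu>_def)
    have bound: "trunc_mean s \<le> s powr (- b') * \<mu>" if "s > 0" for s
    proof -
      have "ennreal (trunc_mean s) \<le> (\<integral>\<^sup>+t. ennreal (s powr (- b')) * ennreal (t powr b') \<partial>prior)"
        unfolding ennreal_trunc_mean[OF that]
      proof (rule nn_integral_mono_AE, use AE_prior_pos in eventually_elim)
        case (elim t)
        have "min (t / s) 1 \<le> (t / s) powr b'"
        proof (cases "t \<le> s")
          case True
          have "(t / s) powr 1 \<le> (t / s) powr b'"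
            using True elim that b' by (intro powr_mono') auto
          then show ?thesis using True elim that by (simp add: min_def)
        next
          case False
          then have "1 \<le> (t / s) powr b'" using that b' by (intro ge_one_powr_ge_zero) auto
          then show ?thesis by simp
        qed
        also have "\<dots> = s powr (- b') * t powr b'"
          using elim that by (simp add: powr_divide powr_minus field_simps)
        finally show ?case by (simp add: ennreal_leI flip: ennreal_mult')
      qed
      also have "\<dots> = ennreal (s powr (- b') * \<mu>)"
        by (subst nn_integral_cmult) (auto simp: \<mu>(1)[symmetric] ennreal_mult')
      finally show ?thesis using \<mu>(2) by (simp add: ennreal_le_iff)
    qed
    have "((\<lambda>s. \<mu> * s powr (1/2 - b')) \<longlongrightarrow> \<mu> * 0) at_top"
      using b' by (intro tendsto_intros tendsto_neg_powr filterlim_ident) auto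
    then have "\<forall>\<^sub>F s in at_top. \<mu> * s powr (1/2 - b') < e"
      using e by (auto dest: order_tendstoD)
    then show ?thesis using eventually_ge_at_top[of "exp 2"]
    proof eventually_elim
      case (elim s)
      have s: "s > 0" using elim(2) exp_gt_zero[of "2::real"] by linarith
      have ln_s: "ln s \<ge> 2" using elim s by (simp add: ln_ge_iff)
      have s1: "s > 1" using less_le_trans[OF exp_gt_one elim(2)] by simp
      have "trunc_mean s * sqrt s / sqrt (ln s) \<le> trunc_mean s * sqrt s / 1"
        using ln_s s1 s trunc_mean_nonneg[OF s] by (intro divide_left_mono) auto
      also have "\<dots> \<le> (s powr (- b') * \<mu>) * s powr (1/2) / 1"
        using bound[OF s] s by (simp add: powr_half_sqrt mult_right_mono)
      also have "\<dots> = \<mu> * (s powr (- b') * s powr (1/2))" by simp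
      also have "s powr (- b') * s powr (1/2) = s powr (1/2 - b')" by (simp flip: powr_add)
      finally show ?case using elim(1) by simp
    qed
  next
    assume a: "a = 1/2" and lim: "((\<lambda>t. L t / sqrt (ln t)) \<longlongrightarrow> 0) at_top"
    define I where "I = enn2real (\<integral>\<^sup>+u. ennreal (tail_profile u) \<partial>lborel)"
    have I: "ennreal I = (\<integral>\<^sup>+u. ennreal (tail_profile u) \<partial>lborel)" "I \<ge> 0"
      using tail_profile_integral_finite by (auto simp: I_def)
    \<comment> \<open>Chosen so that the main term e' * K * I stays below e / 2; I + 1 keeps the
      denominator positive.\<close>
    define e' where "e' = e / (2 * K * (I + 1))"
    have e': "e' > 0" using e K_pos I by (simp add: e'_def)
    have "K \<noteq> 0" "I + 1 \<noteq> 0" using K_pos I(2) by auto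
    then have "e' * K * I = e / 2 * (I / (I + 1))" by (simp add: e'_def divide_simps)
    also have "\<dots> \<le> e / 2 * 1" using e I by (intro mult_left_mono) auto
    finally have e'2: "e' * K * I \<le> e / 2" by simp
    have "\<forall>\<^sub>F t in at_top. L t / sqrt (ln t) < e'"
      using lim e' by (auto dest: order_tendstoD)
    then obtain B0 where B0: "\<And>t. t \<ge> B0 \<Longrightarrow> L t / sqrt (ln t) < e'"
      by (auto simp: eventually_at_top_linorder)
    define B where "B = max (exp 2) B0"
    have B_pos: "B > 0" using exp_gt_zero[of "2::real"] unfolding B_def by linarith
    have B1: "B \<ge> 1" using one_le_exp_iff[of "2::real"] unfolding B_def by linarith
    have LB: "L t \<le> e' * sqrt (ln t)" if "t \<ge> B" for t
    proof -
      have "t \<ge> exp 2" "t \<ge> B0" "t > 0" using that B_pos by (auto simp: B_def)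
      then have "ln t \<ge> 2" by (simp add: ln_ge_iff)
      then show ?thesis using B0[OF \<open>t \<ge> B0\<close>] by (simp add: field_simps)
    qed
    have bound: "trunc_mean s \<le> B / s + e' * K * sqrt (ln s) * (I / sqrt s)" if "s \<ge> exp 2" for s
    proof -
      have s: "s > 0" using that exp_gt_zero[of "2::real"] by linarith
      have ln_s: "ln s \<ge> 2" using that s by (simp add: ln_ge_iff)
      have s1: "s > 1" using less_le_trans[OF exp_gt_one that] by simp
      define c where "c = e' * K * sqrt (ln s) * s powr (- 3/2)"
      have c: "c \<ge> 0" using e' K_pos ln_s s1 by (simp add: c_def)
      have "ennreal (trunc_mean s) = (\<integral>\<^sup>+t. ennreal (min (t / s) 1) \<partial>prior)"
        by (rule ennreal_trunc_mean[OF s])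
      \<comment> \<open>Below \<open>B\<close>, where \<open>L\<close> is not controlled, the
        integrand is at most B / s, which is negligible against sqrt (ln s / s).\<close>
      also have "\<dots> \<le> (\<integral>\<^sup>+t. ennreal (B / s) + ennreal (min (t / s) 1) * indicator {B..} t \<partial>prior)"
      proof (rule nn_integral_mono)
        fix t
        have "min (t / s) 1 \<le> B / s" if "t \<le> B" using that s by (simp add: min.coboundedI1 divide_right_mono)
        then show "ennreal (min (t / s) 1) \<le> ennreal (B / s) + ennreal (min (t / s) 1) * indicator {B..} t"
          by (auto split: split_indicator intro!: ennreal_leI)
      qed
      also have "\<dots> = ennreal (B / s) + (\<integral>\<^sup>+t. ennreal (min (t / s) 1) * indicator {B..} t \<partial>prior)"
        using Q.emeasure_space_1 by (subst nn_integral_add) auto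
      also have "(\<integral>\<^sup>+t. ennreal (min (t / s) 1) * indicator {B..} t \<partial>prior)
          = (\<integral>\<^sup>+t. ennreal (prior_pdf t) * (ennreal (min (t / s) 1) * indicator {B..} t) \<partial>lborel)"
        by (rule nn_integral_prior) measurable
      also have "\<dots> \<le> (\<integral>\<^sup>+t. ennreal (c * tail_profile (t / s)) \<partial>lborel)"
      proof (rule nn_integral_mono)
        fix t :: real
        have "prior_pdf t * min (t / s) 1 \<le> c * tail_profile (t / s)" if t: "t \<ge> B"
        proof -
          have t_pos: "t > 0" using t B_pos by simp
          have "L t \<le> e' * sqrt (ln t)" by (rule LB[OF t])
          also have "\<dots> \<le> e' * (sqrt (ln s) * max 1 ((t / s) powr (1/4)))"
            using e' t B1 \<open>s \<ge> exp 2\<close> by (intro mult_left_mono sqrt_ln_le) auto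
          finally have "K * t powr (- 3/2) * L t * min (t / s) 1
              \<le> K * t powr (- 3/2) * (e' * (sqrt (ln s) * max 1 ((t / s) powr (1/4)))) * min (t / s) 1"
            using K_pos t_pos s by (intro mult_left_mono mult_right_mono) auto
          also have "\<dots> = c * tail_profile (t / s)"
          proof -
            have "t powr (- 3/2) = s powr (- 3/2) * (t / s) powr (- 3/2)"
              using t_pos s by (simp flip: powr_mult)
            then show ?thesis using t_pos s by (simp only: c_def tail_profile_def) (simp add: ac_simps)
          qed
          also have "K * t powr (- 3/2) * L t * min (t / s) 1 = prior_pdf t * min (t / s) 1"
          proof -
            have "- a - 1 = - 3/2" using a by simp
            then show ?thesis using t_pos by (simp only: prior_pdf_def mixing_density_def if_True)
          qed
          finally show ?thesis .
        qed
        then show "ennreal (prior_pdf t) * (ennreal (min (t / s) 1) * indicator {B..} t) \<le> ennreal (c * tail_profile (t / s))"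
          using prior_pdf_nonneg[of t]
          by (auto split: split_indicator simp flip: ennreal_mult' intro!: ennreal_leI)
      qed
      \<comment> \<open>Substitution t = s * u; the prefactor s * c that results is of order sqrt
        (ln s / s).\<close>
      also have "\<dots> = (\<integral>\<^sup>+u. ennreal s * ennreal (c * tail_profile u) \<partial>lborel)"
        by (subst nn_integral_real_affine[where c=s and t=0]) (use s in \<open>auto simp: nn_integral_cmult\<close>)
      also have "\<dots> = ennreal (s * c) * ennreal I"
        using s c by (simp add: ennreal_mult' nn_integral_cmult I(1) mult.assoc)
      also have "ennreal (B / s) + ennreal (s * c) * ennreal I = ennreal (B / s + s * c * I)"
        using s c I B_pos by (simp add: ennreal_mult ennreal_plus)
      finally have "ennreal (trunc_mean s) \<le> ennreal (B / s + s * c * I)"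
        by (blast intro: add_left_mono)
      then have "trunc_mean s \<le> B / s + s * c * I"
        using s c I B_pos by (subst (asm) ennreal_le_iff) auto
      also have "s * c = e' * K * sqrt (ln s) / sqrt s"
      proof -
        have "s * s powr (- 3/2) = s powr (- 1/2)" using s powr_add[of s 1 "-3/2"] by simp
        also have "\<dots> = 1 / sqrt s" using s by (simp add: powr_minus_divide powr_half_sqrt[symmetric])
        finally have eq: "s * s powr (- 3/2) = 1 / sqrt s" .
        have "s * c = e' * K * sqrt (ln s) * (s * s powr (- 3/2))" by (simp add: c_def)
        also have "\<dots> = e' * K * sqrt (ln s) / sqrt s" unfolding eq by simp
        finally show ?thesis .
      qed
      finally show ?thesis by simp
    qed
    have "\<forall>\<^sub>F s::real in at_top. B / sqrt s < e / 2"
      using e by (intro order_tendstoD(2)[where y=0]) (real_asymp, simp)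
    then show ?thesis using eventually_ge_at_top[of "exp 2"]
    proof eventually_elim
      case (elim s)
      have s: "s > 0" using elim(2) exp_gt_zero[of "2::real"] by linarith
      have ln_s: "ln s \<ge> 2" using elim s by (simp add: ln_ge_iff)
      have s1: "s > 1" using less_le_trans[OF exp_gt_one elim(2)] by simp
      have "trunc_mean s * sqrt s / sqrt (ln s)
          \<le> (B / s + e' * K * sqrt (ln s) * (I / sqrt s)) * sqrt s / sqrt (ln s)"
        using bound[OF elim(2)] ln_s s1 s by (intro divide_right_mono mult_right_mono) auto
      also have "\<dots> = B / (sqrt s * sqrt (ln s)) + e' * K * I"
      proof -
        have *: "(B / (r * r) + e' * K * l * (I / r)) * r / l = B / (r * l) + e' * K * I"
          if "r > 0" "l > 0" for r l using that by (simp add: field_simps)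
        show ?thesis using *[of "sqrt s" "sqrt (ln s)"] s s1 by simp
      qed
      also have "B / (sqrt s * sqrt (ln s)) \<le> B / (sqrt s * 1)"
        using s ln_s s1 B_pos by (intro divide_left_mono mult_left_mono mult_pos_pos) auto
      finally have "trunc_mean s * sqrt s / sqrt (ln s) \<le> B / sqrt s + e' * K * I" by simp
      then show ?case using elim(1) e'2 by linarith
    qed
  qed
  then show "\<forall>\<^sub>F s in at_top. dist (trunc_mean s * sqrt s / sqrt (ln s)) 0 < e"
    using eventually_ge_at_top[of "exp 2"]
  proof eventually_elim
    case (elim s)
    then show ?case unfolding dist_real_def using nonneg[OF elim(2)] by linarith
  qed
qed

end

section \<open>Posterior shrinkage\<close>

text \<open>\<kappa> as a function of the value \<open>t\<close> of the squared local scale.\<close>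

definition shrinkage :: "real \<Rightarrow> real \<Rightarrow> real" where
  "shrinkage \<tau> t = 1 / (1 + t * \<tau>\<^sup>2)"

text \<open>Up to 1 / sqrt (2 * pi), the density at \<open>x\<close> of N(0, 1 / \<kappa>), the law
  of the observation given \<open>t\<close>.\<close>

definition shrinkage_lik :: "real \<Rightarrow> real \<Rightarrow> real \<Rightarrow> real" where
  "shrinkage_lik \<tau> x t = sqrt (shrinkage \<tau> t) * exp (- shrinkage \<tau> t * x\<^sup>2 / 2)"

lemma shrinkage_measurable [measurable]: "shrinkage \<tau> \<in> borel_measurable borel"
  unfolding shrinkage_def by measurable

lemma shrinkage_lik_measurable [measurable]: "shrinkage_lik \<tau> x \<in> borel_measurable borel"
  unfolding shrinkage_lik_def by measurable

lemma shrinkage_bounds: "t > 0 \<Longrightarrow> 0 < shrinkage \<tau> t \<and> shrinkage \<tau> t \<le> 1"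
  by (auto simp: shrinkage_def add_pos_nonneg)

lemma abs_shrinkage_le: "t > 0 \<Longrightarrow> \<bar>shrinkage \<tau> t\<bar> \<le> 1"
  using shrinkage_bounds[of t \<tau>] by simp

lemma shrinkage_lik_bounds:
  assumes "t > 0"
  shows "0 < shrinkage_lik \<tau> x t" "shrinkage_lik \<tau> x t \<le> 1"
proof -
  note * = shrinkage_bounds[OF assms, of \<tau>]
  show "0 < shrinkage_lik \<tau> x t" using * by (simp add: shrinkage_lik_def)
  have "shrinkage_lik \<tau> x t \<le> 1 * 1"
    unfolding shrinkage_lik_def using * by (intro mult_mono) auto
  then show "shrinkage_lik \<tau> x t \<le> 1" by simp
qed

lemma shrinkage_image:
  assumes "\<tau> > 0"
  shows "shrinkage \<tau> ` {0<..} = {0<..<1}"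
proof (intro equalityI subsetI)
  fix \<kappa> assume "\<kappa> \<in> shrinkage \<tau> ` {0<..}"
  then show "\<kappa> \<in> {0<..<1}" using assms by (auto simp: shrinkage_def add_pos_pos)
next
  fix \<kappa> :: real assume \<kappa>: "\<kappa> \<in> {0<..<1}"
  then have "\<kappa> = shrinkage \<tau> (1 / \<tau>\<^sup>2 * (1 / \<kappa> - 1))" "1 / \<tau>\<^sup>2 * (1 / \<kappa> - 1) > 0"
    using assms by (auto simp: shrinkage_def field_simps)
  then show "\<kappa> \<in> shrinkage \<tau> ` {0<..}" by blast
qed

lemma inj_on_shrinkage:
  assumes "\<tau> > 0"
  shows "inj_on (shrinkage \<tau>) {0<..}"
proof (rule inj_onI)
  fix t u :: real assume *: "t \<in> {0<..}" "u \<in> {0<..}" "shrinkage \<tau> t = shrinkage \<tau> u"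
  have "1 + t * \<tau>\<^sup>2 > 0" "1 + u * \<tau>\<^sup>2 > 0" using * by (auto intro: add_pos_nonneg)
  with * show "t = u" using assms by (auto simp: shrinkage_def divide_simps)
qed

context one_group_prior
begin

lemma integrable_shrinkage_lik:
  assumes [measurable]: "h \<in> borel_measurable borel" and h: "\<And>t. 0 < t \<Longrightarrow> \<bar>h t\<bar> \<le> B"
  shows "integrable prior (\<lambda>t. h t * shrinkage_lik \<tau> x t)"
proof (rule Q.integrable_const_bound[where B=B])
  show "AE t in prior. norm (h t * shrinkage_lik \<tau> x t) \<le> B"
    using AE_prior_pos
  proof eventually_elim
    case (elim t)
    have "\<bar>h t\<bar> * \<bar>shrinkage_lik \<tau> x t\<bar> \<le> B * 1"
      using h[OF elim] shrinkage_lik_bounds[OF elim, of \<tau> x] by (intro mult_mono) auto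
    then show ?case by (simp add: abs_mult)
  qed
qed measurable

text \<open>\<open>L\<close> is known to be measurable on the positive half-line only. For 0 <
  \<kappa> < 1 its argument is positive, so its extension by zero may replace it.\<close>

lemma kappa_kernel_measurable:
  assumes "\<tau> > 0" and [measurable]: "h \<in> borel_measurable borel"
  shows "(\<lambda>\<kappa>. indicator {0<..<1} \<kappa> *\<^sub>R (h \<kappa> * kappa_kernel a L \<tau> x \<kappa>)) \<in> borel_measurable borel"
proof -
  have [measurable]: "(\<lambda>t. indicator {0<..} t *\<^sub>R L t) \<in> borel_measurable borel"
    using L_measurable by (subst borel_measurable_restrict_space_iff[symmetric]) auto
  have "(\<lambda>\<kappa>. indicator {0<..<1} \<kappa> * (h \<kappa> * (\<kappa> powr (a + 1/2 - 1) * (1 - \<kappa>) powr (- a - 1)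
      * (indicator {0<..} (1 / \<tau>\<^sup>2 * (1 / \<kappa> - 1)) *\<^sub>R L (1 / \<tau>\<^sup>2 * (1 / \<kappa> - 1))) * exp (- \<kappa> * x\<^sup>2 / 2))))
     \<in> borel_measurable borel"
    by measurable
  also have "(\<lambda>\<kappa>. indicator {0<..<1} \<kappa> * (h \<kappa> * (\<kappa> powr (a + 1/2 - 1) * (1 - \<kappa>) powr (- a - 1)
      * (indicator {0<..} (1 / \<tau>\<^sup>2 * (1 / \<kappa> - 1)) *\<^sub>R L (1 / \<tau>\<^sup>2 * (1 / \<kappa> - 1))) * exp (- \<kappa> * x\<^sup>2 / 2))))
     = (\<lambda>\<kappa>. indicator {0<..<1} \<kappa> *\<^sub>R (h \<kappa> * kappa_kernel a L \<tau> x \<kappa>))"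
    using assms by (auto simp: fun_eq_iff kappa_kernel_def field_simps split: split_indicator)
  finally show ?thesis .
qed

text \<open>\<open>\<tau>\<^sup>2 * (shrinkage \<tau> t)\<^sup>2\<close> is the absolute derivative
  of the substitution. As 1 - \<kappa> = \<kappa> * t * \<tau>^2, the exponents of \<kappa> add up
  to 1/2 and those of \<tau> to - 2 * a; the leftover factor is free of \<open>t\<close> and cancels
  in the posterior.\<close>

lemma kappa_kernel_shrinkage:
  assumes \<tau>: "\<tau> > 0" and t: "t > 0"
  shows "\<tau>\<^sup>2 * (shrinkage \<tau> t)\<^sup>2 * kappa_kernel a L \<tau> x (shrinkage \<tau> t)
    = \<tau> powr (- 2 * a) / K * (prior_pdf t * shrinkage_lik \<tau> x t)"
proof -
  define \<kappa> where "\<kappa> = shrinkage \<tau> t"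
  have pos: "1 + t * \<tau>\<^sup>2 > 0" using \<tau> t by (simp add: add_pos_pos)
  have \<kappa>: "\<kappa> > 0" "\<kappa> < 1" using pos \<tau> t by (auto simp: \<kappa>_def shrinkage_def)
  have arg: "1 / \<tau>\<^sup>2 * (1 / \<kappa> - 1) = t" using \<tau> by (simp add: \<kappa>_def shrinkage_def)
  have odds: "1 - \<kappa> = \<kappa> * (t * \<tau>\<^sup>2)" using pos by (simp add: \<kappa>_def shrinkage_def field_simps)
  have "\<tau>\<^sup>2 * \<kappa>\<^sup>2 * (\<kappa> powr (a + 1/2 - 1) * (1 - \<kappa>) powr (- a - 1))
      = (\<kappa> powr 2 * \<kappa> powr (a + 1/2 - 1) * \<kappa> powr (- a - 1)) * (\<tau> powr 2 * (\<tau> powr 2) powr (- a - 1)) * t powr (- a - 1)"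
    using \<kappa> \<tau> t by (simp add: odds powr_mult)
  also have "\<kappa> powr 2 * \<kappa> powr (a + 1/2 - 1) * \<kappa> powr (- a - 1) = sqrt \<kappa>"
  proof -
    have "2 + (a + 1/2 - 1) + (- a - 1) = 1/2" by simp
    then have "\<kappa> powr 2 * \<kappa> powr (a + 1/2 - 1) * \<kappa> powr (- a - 1) = \<kappa> powr (1/2)"
      by (metis powr_add)
    then show ?thesis using \<kappa> by (simp add: powr_half_sqrt)
  qed
  also have "\<tau> powr 2 * (\<tau> powr 2) powr (- a - 1) = \<tau> powr (- 2 * a)"
  proof -
    have "2 + 2 * (- a - 1) = - 2 * a" by simp
    then show ?thesis by (metis powr_add powr_powr)
  qed
  finally have "\<tau>\<^sup>2 * \<kappa>\<^sup>2 * (\<kappa> powr (a + 1/2 - 1) * (1 - \<kappa>) powr (- a - 1))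
      = sqrt \<kappa> * \<tau> powr (- 2 * a) * t powr (- a - 1)" .
  then have "\<tau>\<^sup>2 * \<kappa>\<^sup>2 * kappa_kernel a L \<tau> x \<kappa>
      = sqrt \<kappa> * \<tau> powr (- 2 * a) * t powr (- a - 1) * L t * exp (- \<kappa> * x\<^sup>2 / 2)"
    unfolding kappa_kernel_def arg by (metis (no_types, opaque_lifting) mult.assoc)
  also have "\<dots> = \<tau> powr (- 2 * a) / K * (prior_pdf t * shrinkage_lik \<tau> x t)"
    using t K_pos by (simp add: prior_pdf_def mixing_density_def shrinkage_lik_def \<kappa>_def)
  finally show ?thesis by (simp add: \<kappa>_def)
qed

text \<open>Change of variables between \<kappa> and \<open>t\<close>. The weight \<open>h\<close>
  covers the normalising constant (constantly 1) and the numerator of the posterior mean (the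
  identity).\<close>

lemma integral_kappa_kernel:
  assumes \<tau>: "\<tau> > 0" and [measurable]: "h \<in> borel_measurable borel"
    and h: "\<And>\<kappa>. \<lbrakk>0 < \<kappa>; \<kappa> \<le> 1\<rbrakk> \<Longrightarrow> \<bar>h \<kappa>\<bar> \<le> B"
  shows "(LBINT \<kappa>:{0<..<1}. h \<kappa> * kappa_kernel a L \<tau> x \<kappa>)
    = \<tau> powr (- 2 * a) / K * Q.expectation (\<lambda>t. h (shrinkage \<tau> t) * shrinkage_lik \<tau> x t)"
proof -
  define c where "c = \<tau> powr (- 2 * a) / K"
  define f where "f \<kappa> = h \<kappa> * kappa_kernel a L \<tau> x \<kappa>" for \<kappa>
  define g' where "g' t = - \<tau>\<^sup>2 * (shrinkage \<tau> t)\<^sup>2" for t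
  define H where "H t = h (shrinkage \<tau> t) * shrinkage_lik \<tau> x t" for t
  have [measurable]: "H \<in> borel_measurable borel" unfolding H_def by measurable
  have "integrable prior H"
    unfolding H_def by (rule integrable_shrinkage_lik[where B=B]) (simp_all add: h shrinkage_bounds)
  then have int: "integrable lborel (\<lambda>t. prior_pdf t * H t)"
    and exp: "Q.expectation H = (\<integral>t. prior_pdf t * H t \<partial>lborel)"
    using prior_pdf_nonneg unfolding prior_def
    by (auto simp: integrable_real_density integral_real_density)
  have eq: "indicator {0<..} t *\<^sub>R (\<bar>g' t\<bar> * f (shrinkage \<tau> t)) = c * (prior_pdf t * H t)" for t
  proof (cases "t > 0")
    case True
    then show ?thesis
      using kappa_kernel_shrinkage[OF \<tau> True, of x]
      by (simp add: g'_def f_def H_def c_def abs_mult mult.assoc mult.left_commute)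
  qed (simp add: prior_pdf_def)
  have set_int: "set_integrable lborel {0<..} (\<lambda>t. \<bar>g' t\<bar> * f (shrinkage \<tau> t))"
    using int unfolding set_integrable_def eq by simp
  have val: "integral {0<..} (\<lambda>t. \<bar>g' t\<bar> * f (shrinkage \<tau> t)) = c * Q.expectation H"
    using set_borel_integral_eq_integral(2)[OF set_int]
    unfolding set_lebesgue_integral_def eq exp by simp
  have "(\<lambda>t. \<bar>g' t\<bar> * f (shrinkage \<tau> t)) absolutely_integrable_on {0<..}"
    using set_int unfolding set_integrable_def
    by (subst integrable_completion) auto
  \<comment> \<open>The rule is an equivalence that couples integrability with the value, so
    integrability of the kernel on (0, 1) is obtained from the prior side.\<close>
  moreover have "((\<lambda>t. \<bar>g' t\<bar> * f (shrinkage \<tau> t)) absolutely_integrable_on {0<..} \<and>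
      integral {0<..} (\<lambda>t. \<bar>g' t\<bar> * f (shrinkage \<tau> t)) = c * Q.expectation H)
     \<longleftrightarrow> (f absolutely_integrable_on (shrinkage \<tau> ` {0<..}) \<and> integral (shrinkage \<tau> ` {0<..}) f = c * Q.expectation H)"
  proof (rule has_absolute_integral_change_of_variables_1')
    fix t :: real assume "t \<in> {0<..}"
    then have "1 + t * \<tau>\<^sup>2 > 0" by (simp add: add_pos_nonneg)
    then show "(shrinkage \<tau> has_real_derivative g' t) (at t within {0<..})"
      unfolding shrinkage_def g'_def
      by (auto intro!: derivative_eq_intros simp: power2_eq_square field_simps)
  qed (use inj_on_shrinkage[OF \<tau>] in auto)
  ultimately have abs: "f absolutely_integrable_on {0<..<1}" and int_f: "integral {0<..<1} f = c * Q.expectation H"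
    using val by (auto simp: shrinkage_image[OF \<tau>])
  \<comment> \<open>Absolute integrability refers to the completed Lebesgue measure; Borel
    measurability of the kernel leads back to \<open>lborel\<close>.\<close>
  have "set_integrable lborel {0<..<1} f"
    using abs kappa_kernel_measurable[OF \<tau>, of h x] unfolding set_integrable_def f_def
    by (subst (asm) integrable_completion) auto
  from set_borel_integral_eq_integral(2)[OF this] int_f show ?thesis
    by (simp add: f_def H_def[abs_def] c_def)
qed

lemma expectation_shrinkage_lik_pos: "Q.expectation (shrinkage_lik \<tau> x) > 0"
proof -
  have "integrable prior (shrinkage_lik \<tau> x)"
    using integrable_shrinkage_lik[of "\<lambda>_. 1" 1] by simp
  moreover have "AE t in prior. 0 < shrinkage_lik \<tau> x t"
    using AE_prior_pos by eventually_elim (rule shrinkage_lik_bounds)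
  ultimately show ?thesis by (rule Q.expectation_greater)
qed

lemma kappa_posterior_mean_eq:
  assumes "\<tau> > 0"
  shows "kappa_posterior_mean a L \<tau> x
    = Q.expectation (\<lambda>t. shrinkage \<tau> t * shrinkage_lik \<tau> x t) / Q.expectation (shrinkage_lik \<tau> x)"
proof -
  define c where "c = \<tau> powr (- 2 * a) / K"
  have c: "c \<noteq> 0" using assms K_pos by (simp add: c_def)
  have den: "(LBINT u:{0<..<1}. kappa_kernel a L \<tau> x u) = c * Q.expectation (shrinkage_lik \<tau> x)"
    using integral_kappa_kernel[OF assms, of "\<lambda>_. 1" 1 x] unfolding c_def by simp
  have num: "(LBINT \<kappa>:{0<..<1}. \<kappa> * kappa_kernel a L \<tau> x \<kappa>)
      = c * Q.expectation (\<lambda>t. shrinkage \<tau> t * shrinkage_lik \<tau> x t)"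
    using integral_kappa_kernel[OF assms, of "\<lambda>\<kappa>. \<kappa>" 1 x] unfolding c_def by simp
  have "kappa_posterior_mean a L \<tau> x = (LBINT \<kappa>:{0<..<1}. \<kappa> * kappa_kernel a L \<tau> x \<kappa>)
      / (LBINT u:{0<..<1}. kappa_kernel a L \<tau> x u)"
    unfolding kappa_posterior_mean_def kappa_posterior_density_def times_divide_eq_right
    by (rule set_integral_divide_zero)
  then show ?thesis
    unfolding num den using c by (rule trans[OF _ mult_divide_mult_cancel_left])
qed

text \<open>In the numerator the likelihood is replaced by 1 and 1 - \<kappa> by its truncated
  majorant. In the denominator \<tau> \<le> 1 gives \<kappa> \<ge> \<open>shrinkage 1 t\<close>, and
  \<kappa> \<le> 1 bounds the exponential below by exp (- x^2 / 2); what remains is a constant free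
  of \<tau> and \<open>x\<close>.\<close>

lemma one_minus_posterior_mean_le:
  assumes \<tau>: "0 < \<tau>" "\<tau> \<le> 1"
  shows "1 - kappa_posterior_mean a L \<tau> x
    \<le> trunc_mean (1 / \<tau>\<^sup>2) * exp (x\<^sup>2 / 2) / Q.expectation (\<lambda>t. sqrt (shrinkage 1 t))"
proof -
  define E where "E = Q.expectation (shrinkage_lik \<tau> x)"
  define D where "D = Q.expectation (\<lambda>t. sqrt (shrinkage 1 t))"
  have intE: "integrable prior (shrinkage_lik \<tau> x)"
    using integrable_shrinkage_lik[of "\<lambda>_. 1" 1] by simp
  have intD: "integrable prior (\<lambda>t. sqrt (shrinkage 1 t))"
    using AE_prior_pos
    by (intro Q.integrable_const_bound[where B=1])
       (auto elim!: eventually_mono simp: shrinkage_bounds shrinkage_bounds[THEN conjunct1, THEN less_imp_le])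
  have intk: "integrable prior (\<lambda>t. shrinkage \<tau> t * shrinkage_lik \<tau> x t)"
    by (rule integrable_shrinkage_lik[where B=1]) (use abs_shrinkage_le in auto)
  have E: "E > 0" unfolding E_def by (rule expectation_shrinkage_lik_pos)
  \<comment> \<open>\<open>D\<close> is the mean likelihood at \<tau> = 1 and x = 0.\<close>
  have D: "D > 0"
    using expectation_shrinkage_lik_pos[of 1 0] by (simp add: shrinkage_lik_def[abs_def] D_def)
  have ED: "exp (- x\<^sup>2 / 2) * D \<le> E"
  proof -
    have "Q.expectation (\<lambda>t. exp (- x\<^sup>2 / 2) * sqrt (shrinkage 1 t)) \<le> E"
      unfolding E_def
    proof (rule integral_mono_AE)
      show "AE t in prior. exp (- x\<^sup>2 / 2) * sqrt (shrinkage 1 t) \<le> shrinkage_lik \<tau> x t"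
        using AE_prior_pos
      proof eventually_elim
        case (elim t)
        have "\<tau>\<^sup>2 \<le> 1" using \<tau> by (simp add: power_le_one)
        then have "t * \<tau>\<^sup>2 \<le> t * 1" using elim by (intro mult_left_mono) auto
        then have "shrinkage 1 t \<le> shrinkage \<tau> t"
          using elim by (auto simp: shrinkage_def intro!: divide_left_mono mult_pos_pos add_pos_nonneg)
        moreover have "shrinkage \<tau> t * x\<^sup>2 \<le> 1 * x\<^sup>2"
          using shrinkage_bounds[OF elim, of \<tau>] by (intro mult_right_mono) auto
        ultimately have "sqrt (shrinkage 1 t) * exp (- x\<^sup>2 / 2) \<le> shrinkage_lik \<tau> x t"
          unfolding shrinkage_lik_def using shrinkage_bounds[OF elim, of \<tau>]
          by (intro mult_mono) auto
        then show ?case by (simp add: mult.commute)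
      qed
    qed (use intE intD in auto)
    then show ?thesis by (simp add: D_def)
  qed
  have num: "Q.expectation (\<lambda>t. shrinkage_lik \<tau> x t - shrinkage \<tau> t * shrinkage_lik \<tau> x t) \<le> trunc_mean (1 / \<tau>\<^sup>2)"
    unfolding trunc_mean_def
  proof (rule integral_mono_AE)
    show "AE t in prior. shrinkage_lik \<tau> x t - shrinkage \<tau> t * shrinkage_lik \<tau> x t \<le> min (t / (1 / \<tau>\<^sup>2)) 1"
      using AE_prior_pos
    proof eventually_elim
      case (elim t)
      have pos: "1 + t * \<tau>\<^sup>2 > 0" using elim by (simp add: add_pos_nonneg)
      have "1 - shrinkage \<tau> t = t * \<tau>\<^sup>2 / (1 + t * \<tau>\<^sup>2)" using pos by (simp add: shrinkage_def field_simps)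
      also have "\<dots> \<le> t * \<tau>\<^sup>2 / 1" using elim pos by (intro divide_left_mono) auto
      finally have 1: "1 - shrinkage \<tau> t \<le> min (t / (1 / \<tau>\<^sup>2)) 1"
        using shrinkage_bounds[OF elim, of \<tau>] by simp
      have "(1 - shrinkage \<tau> t) * shrinkage_lik \<tau> x t \<le> (1 - shrinkage \<tau> t) * 1"
        using shrinkage_bounds[OF elim, of \<tau>] shrinkage_lik_bounds[OF elim, of \<tau> x] by (intro mult_left_mono) auto
      then show ?case using 1 by (simp add: algebra_simps)
    qed
    show "integrable prior (\<lambda>t. min (t / (1 / \<tau>\<^sup>2)) 1)" using \<tau> by (intro integrable_trunc) simp
  qed (use intE intk in auto)
  have "1 - kappa_posterior_mean a L \<tau> x
      = Q.expectation (\<lambda>t. shrinkage_lik \<tau> x t - shrinkage \<tau> t * shrinkage_lik \<tau> x t) / E"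
    using E intE intk \<tau> by (simp add: kappa_posterior_mean_eq E_def[symmetric] diff_divide_distrib)
  also have "\<dots> \<le> trunc_mean (1 / \<tau>\<^sup>2) / E" using num E by (intro divide_right_mono) auto
  also have "\<dots> \<le> trunc_mean (1 / \<tau>\<^sup>2) / (exp (- x\<^sup>2 / 2) * D)"
    using ED E D \<tau> by (intro divide_left_mono trunc_mean_nonneg) auto
  also have "\<dots> = trunc_mean (1 / \<tau>\<^sup>2) * exp (x\<^sup>2 / 2) / D"
    by (simp add: exp_minus field_simps)
  finally show ?thesis by (simp add: D_def)
qed

text \<open>Where \<kappa> > \<eta> the likelihood is at most exp (- \<eta> * x^2 / 2). The
  normalising integral is at least its part over a band with \<kappa> \<le> \<eta> * d, whose prior
  mass decays at most polynomially. The quotient of the two exponentials leaves the rate \<eta> * (1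
  - d).\<close>

lemma posterior_mean_le:
  assumes \<eta>: "0 < \<eta>" "\<eta> < 1" and d: "0 < d" "d < 1" and b: "a < b"
  obtains C s0 where "C > 0" "s0 \<ge> 1"
    "\<And>\<tau> x. \<lbrakk>\<tau> > 0; s0 \<le> 1 / \<tau>\<^sup>2\<rbrakk> \<Longrightarrow>
       kappa_posterior_mean a L \<tau> x \<le> \<eta> + C * (1 / \<tau>\<^sup>2) powr b * exp (- \<eta> * (1 - d) * x\<^sup>2 / 2)"
proof -
  \<comment> \<open>With s = 1 / \<tau>^2, t = A * s corresponds to \<kappa> = \<eta> * d.\<close>
  define A where "A = 1 / (\<eta> * d) - 1"
  have "\<eta> * d < 1 * 1" using \<eta> d by (intro mult_strict_mono) auto
  then have A: "A > 0" using \<eta> d by (simp add: A_def field_simps)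
  obtain c s0 where c: "c > 0" "s0 \<ge> 1" and cs: "\<And>s. s \<ge> s0 \<Longrightarrow> c * s powr (- b) \<le> Q.prob {A * s..3 * A * s}"
    using prior_interval_lower_bound[OF b A] by blast
  \<comment> \<open>The least value of sqrt \<kappa> on the band from A * s to 3 * A * s.\<close>
  define q where "q = sqrt (1 / (1 + 3 * A))"
  have q: "q > 0" using A by (simp add: q_def)
  show ?thesis
  proof (rule that[of "1 / (q * c)" s0])
    fix \<tau> x :: real assume \<tau>: "\<tau> > 0" and s: "s0 \<le> 1 / \<tau>\<^sup>2"
    define s where "s = 1 / \<tau>\<^sup>2"
    have s_pos: "s > 0" using \<tau> by (simp add: s_def)
    have shr: "shrinkage \<tau> t = 1 / (1 + t / s)" for t by (simp add: shrinkage_def s_def)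
    define E where "E = Q.expectation (shrinkage_lik \<tau> x)"
    have intE: "integrable prior (shrinkage_lik \<tau> x)"
      using integrable_shrinkage_lik[of "\<lambda>_. 1" 1] by simp
    have intk: "integrable prior (\<lambda>t. shrinkage \<tau> t * shrinkage_lik \<tau> x t)"
      by (rule integrable_shrinkage_lik[where B=1]) (use abs_shrinkage_le in auto)
    have E: "E > 0" unfolding E_def by (rule expectation_shrinkage_lik_pos)
    have lower: "q * exp (- \<eta> * d * x\<^sup>2 / 2) * (c * s powr (- b)) \<le> E"
    proof -
      have "q * exp (- \<eta> * d * x\<^sup>2 / 2) * (c * s powr (- b)) \<le> q * exp (- \<eta> * d * x\<^sup>2 / 2) * Q.prob {A * s..3 * A * s}"
        using cs[OF s] q by (intro mult_left_mono) (auto simp: s_def)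
      also have "\<dots> = Q.expectation (\<lambda>t. q * exp (- \<eta> * d * x\<^sup>2 / 2) * indicator {A * s..3 * A * s} t)"
        by simp
      also have "\<dots> \<le> E" unfolding E_def
      proof (rule integral_mono_AE)
        show "AE t in prior. q * exp (- \<eta> * d * x\<^sup>2 / 2) * indicator {A * s..3 * A * s} t \<le> shrinkage_lik \<tau> x t"
          using AE_prior_pos
        proof eventually_elim
          case (elim t)
          show ?case
          proof (cases "t \<in> {A * s..3 * A * s}")
            case True
            then have t: "A \<le> t / s" "t / s \<le> 3 * A" using s_pos by (auto simp: field_simps)
            have "shrinkage \<tau> t \<le> 1 / (1 + A)" using t A by (auto simp: shr intro!: divide_left_mono)
            also have "1 / (1 + A) = \<eta> * d" using \<eta> d by (simp add: A_def)
            finally have k1: "shrinkage \<tau> t * x\<^sup>2 \<le> \<eta> * d * x\<^sup>2" by (intro mult_right_mono) auto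
            have "1 / (1 + 3 * A) \<le> shrinkage \<tau> t" using t A by (auto simp: shr intro!: divide_left_mono)
            then have "q * exp (- \<eta> * d * x\<^sup>2 / 2) \<le> shrinkage_lik \<tau> x t"
              unfolding q_def shrinkage_lik_def using k1 shrinkage_bounds[OF elim, of \<tau>] A
              by (intro mult_mono) auto
            then show ?thesis using True by simp
          next
            case False
            then show ?thesis using shrinkage_lik_bounds[OF elim, of \<tau> x] by simp
          qed
        qed
      next
        have "integrable prior (indicator {A * s..3 * A * s} :: real \<Rightarrow> real)"
          by (rule integrable_real_indicator) (simp_all add: Q.emeasure_eq_measure)
        then show "integrable prior (\<lambda>t. q * exp (- \<eta> * d * x\<^sup>2 / 2) * indicator {A * s..3 * A * s} t)"
          by (rule integrable_mult_right)
      qed (rule intE)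
      finally show ?thesis .
    qed
    have upper: "Q.expectation (\<lambda>t. shrinkage \<tau> t * shrinkage_lik \<tau> x t) \<le> \<eta> * E + exp (- \<eta> * x\<^sup>2 / 2)"
    proof -
      have "Q.expectation (\<lambda>t. shrinkage \<tau> t * shrinkage_lik \<tau> x t)
          \<le> Q.expectation (\<lambda>t. \<eta> * shrinkage_lik \<tau> x t + exp (- \<eta> * x\<^sup>2 / 2))"
      proof (rule integral_mono_AE)
        show "AE t in prior. shrinkage \<tau> t * shrinkage_lik \<tau> x t \<le> \<eta> * shrinkage_lik \<tau> x t + exp (- \<eta> * x\<^sup>2 / 2)"
          using AE_prior_pos
        proof eventually_elim
          case (elim t)
          note k = shrinkage_bounds[OF elim, of \<tau>] and l = shrinkage_lik_bounds[OF elim, of \<tau> x]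
          show ?case
          proof (cases "shrinkage \<tau> t \<le> \<eta>")
            case True
            then have "shrinkage \<tau> t * shrinkage_lik \<tau> x t \<le> \<eta> * shrinkage_lik \<tau> x t"
              using l by (intro mult_right_mono) auto
            then show ?thesis by (simp add: add_increasing2)
          next
            case False
            then have "\<eta> * x\<^sup>2 \<le> shrinkage \<tau> t * x\<^sup>2" by (intro mult_right_mono) auto
            then have "shrinkage_lik \<tau> x t \<le> 1 * exp (- \<eta> * x\<^sup>2 / 2)"
              unfolding shrinkage_lik_def using k by (intro mult_mono) auto
            moreover have "shrinkage \<tau> t * shrinkage_lik \<tau> x t \<le> 1 * shrinkage_lik \<tau> x t"
              using k l by (intro mult_right_mono) auto
            moreover have "0 \<le> \<eta> * shrinkage_lik \<tau> x t" using \<eta> l by simp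
            ultimately show ?thesis by linarith
          qed
        qed
      qed (use intE intk in auto)
      also have "\<dots> = \<eta> * E + exp (- \<eta> * x\<^sup>2 / 2)"
        using intE Q.prob_space by (simp add: E_def)
      finally show ?thesis .
    qed
    have "kappa_posterior_mean a L \<tau> x \<le> (\<eta> * E + exp (- \<eta> * x\<^sup>2 / 2)) / E"
      using upper E by (simp add: kappa_posterior_mean_eq[OF \<tau>] E_def[symmetric] divide_right_mono)
    also have "\<dots> = \<eta> + exp (- \<eta> * x\<^sup>2 / 2) / E" using E by (simp add: field_simps)
    also have "exp (- \<eta> * x\<^sup>2 / 2) / E \<le> exp (- \<eta> * x\<^sup>2 / 2) / (q * exp (- \<eta> * d * x\<^sup>2 / 2) * (c * s powr (- b)))"
      using lower E q c s_pos by (intro divide_left_mono) auto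
    also have "\<dots> = 1 / (q * c) * s powr b * (exp (- \<eta> * x\<^sup>2 / 2) / exp (- \<eta> * d * x\<^sup>2 / 2))"
      using q c s_pos by (simp add: powr_minus field_simps)
    also have "exp (- \<eta> * x\<^sup>2 / 2) / exp (- \<eta> * d * x\<^sup>2 / 2) = exp (- \<eta> * (1 - d) * x\<^sup>2 / 2)"
      by (simp add: exp_diff[symmetric] field_simps)
    finally show "kappa_posterior_mean a L \<tau> x \<le> \<eta> + 1 / (q * c) * (1 / \<tau>\<^sup>2) powr b * exp (- \<eta> * (1 - d) * x\<^sup>2 / 2)"
      by (simp add: s_def)
  qed (use q c in auto)
qed

end

section \<open>The two-groups model\<close>

text \<open>Exponential Markov inequality, with 1 + y \<le> exp y in each factor. One form serves
  both tails: for l > 0 the event is an upper deviation, for l < 0 a lower one.\<close>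

lemma (in prob_space) chernoff_bernoulli_sum:
  fixes Y :: "'i \<Rightarrow> 'a \<Rightarrow> real"
  assumes I: "finite I" and indep: "indep_vars (\<lambda>_. borel) Y I"
    and Y: "\<And>j \<omega>. j \<in> I \<Longrightarrow> Y j \<omega> \<in> {0, 1}"
    and mean: "\<And>j. j \<in> I \<Longrightarrow> expectation (Y j) = q"
  shows "prob {\<omega> \<in> space M. l * u \<le> l * (\<Sum>j\<in>I. Y j \<omega>)} \<le> exp ((exp l - 1) * q * real (card I) - l * u)"
proof -
  have rv: "random_variable borel (Y j)" if "j \<in> I" for j
    using indep that by (auto simp: indep_vars_def)
  have intY: "integrable M (Y j)" if "j \<in> I" for j
    using rv[OF that] Y[OF that] by (intro integrable_const_bound[where B=1] AE_I2)
      (metis abs_0 abs_1 insertE order_refl real_norm_def singletonD zero_le_one, assumption)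
  have expY: "exp (l * Y j \<omega>) = 1 + (exp l - 1) * Y j \<omega>" if "j \<in> I" for j \<omega>
    using Y[OF that, of \<omega>] by auto
  have int1: "integrable M (\<lambda>\<omega>. exp (l * Y j \<omega>))" if "j \<in> I" for j
    unfolding expY[OF that] using intY[OF that] by simp
  have E1: "expectation (\<lambda>\<omega>. exp (l * Y j \<omega>)) = 1 + (exp l - 1) * q" if "j \<in> I" for j
    unfolding expY[OF that] using intY[OF that] mean[OF that] prob_space by simp
  have ind: "indep_vars (\<lambda>_. borel) (\<lambda>j \<omega>. exp (l * Y j \<omega>)) I"
    by (rule indep_vars_compose2[OF indep]) measurable
  have prod: "exp (l * (\<Sum>j\<in>I. Y j \<omega>)) = (\<Prod>j\<in>I. exp (l * Y j \<omega>))" for \<omega>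
    using I by (simp add: sum_distrib_left exp_sum)
  have int: "integrable M (\<lambda>\<omega>. exp (l * (\<Sum>j\<in>I. Y j \<omega>)))"
    unfolding prod by (rule indep_vars_integrable[OF I ind int1])
  have "expectation (\<lambda>\<omega>. exp (l * (\<Sum>j\<in>I. Y j \<omega>))) = (\<Prod>j\<in>I. expectation (\<lambda>\<omega>. exp (l * Y j \<omega>)))"
    unfolding prod by (rule indep_vars_lebesgue_integral[OF I ind int1])
  also have "\<dots> = (1 + (exp l - 1) * q) ^ card I" using E1 by simp
  also have "\<dots> \<le> exp ((exp l - 1) * q) ^ card I"
  \<comment> \<open>Monotonicity of powers asks for a nonnegative base, which the mean of an
    exponential provides once some index exists. Without an index \<open>q\<close> is arbitrary, but
    the exponent is 0.\<close>
  proof (cases "I = {}")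
    case False
    then obtain j where "j \<in> I" by auto
    then have "0 \<le> 1 + (exp l - 1) * q"
      by (subst E1[symmetric]) (auto intro!: Bochner_Integration.integral_nonneg)
    then show ?thesis by (intro power_mono exp_ge_add_one_self)
  qed simp
  also have "\<dots> = exp ((exp l - 1) * q * real (card I))"
    by (simp add: mult.commute flip: exp_of_nat_mult)
  finally have E: "expectation (\<lambda>\<omega>. exp (l * (\<Sum>j\<in>I. Y j \<omega>))) \<le> exp ((exp l - 1) * q * real (card I))" .
  have "prob {\<omega> \<in> space M. l * u \<le> l * (\<Sum>j\<in>I. Y j \<omega>)}
      = prob {\<omega> \<in> space M. exp (l * u) \<le> exp (l * (\<Sum>j\<in>I. Y j \<omega>))}" by simp
  also have "\<dots> \<le> expectation (\<lambda>\<omega>. exp (l * (\<Sum>j\<in>I. Y j \<omega>))) / exp (l * u)"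
    by (rule integral_Markov_inequality_measure[OF int, where A="{}"]) auto
  also have "\<dots> \<le> exp ((exp l - 1) * q * real (card I)) / exp (l * u)"
    using E by (intro divide_right_mono) auto
  finally show ?thesis by (simp add: exp_diff)
qed

context two_groups
begin

lemma measurable_pair: "i \<in> {1..m} \<Longrightarrow> (\<lambda>\<omega>. (\<nu> i \<omega>, X i \<omega>)) \<in> M \<rightarrow>\<^sub>M count_space UNIV \<Otimes>\<^sub>M borel"
  using indep_pairs by (auto simp: indep_vars_def)

lemma measurable_nu: "i \<in> {1..m} \<Longrightarrow> \<nu> i \<in> M \<rightarrow>\<^sub>M count_space UNIV"
  using measurable_compose[OF measurable_pair measurable_fst] by simp

lemma measurable_X: "i \<in> {1..m} \<Longrightarrow> X i \<in> borel_measurable M"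
  using measurable_compose[OF measurable_pair measurable_snd] by simp

lemma prob_signal:
  assumes i: "i \<in> {1..m}" and p: "0 < p" "p < 1"
  shows "\<P>(\<omega> in M. \<nu> i \<omega>) = p" "\<P>(\<omega> in M. \<not> \<nu> i \<omega>) = 1 - p"
proof -
  note [measurable] = measurable_nu[OF i]
  have "measure (distr M (count_space UNIV) (\<nu> i)) {True} = p"
    using p by (simp add: signal_law[OF i] measure_pmf_single)
  then show *: "\<P>(\<omega> in M. \<nu> i \<omega>) = p"
    by (subst (asm) measure_distr) (auto simp: vimage_def Int_def conj_commute)
  show "\<P>(\<omega> in M. \<not> \<nu> i \<omega>) = 1 - p"
    by (subst prob_neg) (simp_all add: *)
qed

lemma prob_null_and:
  assumes "i \<in> {1..m}" "0 < p" "p < 1" "A \<in> sets borel"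
  shows "\<P>(\<omega> in M. X i \<omega> \<in> A \<and> \<not> \<nu> i \<omega>) = (1 - p) * measure (centred_normal 1) A"
  using null_law[OF assms(1,4)] prob_signal[OF assms(1-3)] assms by (simp add: cond_prob_def field_simps)

lemma prob_alternative_and:
  assumes "i \<in> {1..m}" "0 < p" "p < 1" "A \<in> sets borel"
  shows "\<P>(\<omega> in M. X i \<omega> \<in> A \<and> \<nu> i \<omega>) = p * measure (centred_normal (1 + \<psi>\<^sup>2)) A"
  using alternative_law[OF assms(1,4)] prob_signal[OF assms(1-3)] assms by (simp add: cond_prob_def field_simps)

lemma prob_observation:
  assumes i: "i \<in> {1..m}" and p: "0 < p" "p < 1" and A: "A \<in> sets borel"
  shows "\<P>(\<omega> in M. X i \<omega> \<in> A)
    = (1 - p) * measure (centred_normal 1) A + p * measure (centred_normal (1 + \<psi>\<^sup>2)) A"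
proof -
  note [measurable] = measurable_nu[OF i] measurable_X[OF i] A
  have "\<P>(\<omega> in M. X i \<omega> \<in> A) = prob ({\<omega> \<in> space M. X i \<omega> \<in> A \<and> \<not> \<nu> i \<omega>} \<union> {\<omega> \<in> space M. X i \<omega> \<in> A \<and> \<nu> i \<omega>})"
    by (rule arg_cong[where f=prob]) auto
  also have "\<dots> = \<P>(\<omega> in M. X i \<omega> \<in> A \<and> \<not> \<nu> i \<omega>) + \<P>(\<omega> in M. X i \<omega> \<in> A \<and> \<nu> i \<omega>)"
    by (rule finite_measure_Union) auto
  finally show ?thesis using prob_null_and[OF assms] prob_alternative_and[OF assms] by simp
qed

text \<open>
The events \<open>rej i\<close> need not be measurable: a nonmeasurable set has measure 0, which is harmless in an
upper bound.
\<close>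

lemma bayes_risk_le:
  assumes p: "0 < p" "p < 1" and G: "G \<in> events"
    and null: "\<And>i \<omega>. \<lbrakk>i \<in> {1..m}; \<omega> \<in> G; rej i \<omega>\<rbrakk> \<Longrightarrow> \<theta> \<le> \<bar>X i \<omega>\<bar>"
    and alt: "\<And>i \<omega>. \<lbrakk>i \<in> {1..m}; \<omega> \<in> G; \<not> rej i \<omega>\<rbrakk> \<Longrightarrow> \<bar>X i \<omega>\<bar> \<le> \<theta>'"
  shows "bayes_risk M m p \<nu> rej \<le> real m *
    (measure (centred_normal 1) {x. \<theta> \<le> \<bar>x\<bar>} + p * measure (centred_normal (1 + \<psi>\<^sup>2)) {x. \<bar>x\<bar> \<le> \<theta>'}
      + 2 * prob (space M - G))"
proof -
  define R where "R = measure (centred_normal 1) {x. \<theta> \<le> \<bar>x\<bar>}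
    + p * measure (centred_normal (1 + \<psi>\<^sup>2)) {x. \<bar>x\<bar> \<le> \<theta>'} + 2 * prob (space M - G)"
  have "(1 - p) * \<P>(\<omega> in M. rej i \<omega> \<bar> \<not> \<nu> i \<omega>) + p * \<P>(\<omega> in M. \<not> rej i \<omega> \<bar> \<nu> i \<omega>) \<le> R"
    if i: "i \<in> {1..m}" for i
  proof -
    note [measurable] = measurable_nu[OF i] measurable_X[OF i] G
    \<comment> \<open>The exceptional event is added by a union bound instead of being conditioned
      away, so nothing is asked about how \<open>rej i\<close> depends on the other
      observations.\<close>
    have "\<P>(\<omega> in M. rej i \<omega> \<and> \<not> \<nu> i \<omega>)
        \<le> prob ({\<omega> \<in> space M. X i \<omega> \<in> {x. \<theta> \<le> \<bar>x\<bar>} \<and> \<not> \<nu> i \<omega>} \<union> (space M - G))"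
      using null[OF i] by (intro finite_measure_mono) auto
    also have "\<dots> \<le> \<P>(\<omega> in M. X i \<omega> \<in> {x. \<theta> \<le> \<bar>x\<bar>} \<and> \<not> \<nu> i \<omega>) + prob (space M - G)"
      by (intro measure_Un_le) auto
    also have "\<P>(\<omega> in M. X i \<omega> \<in> {x. \<theta> \<le> \<bar>x\<bar>} \<and> \<not> \<nu> i \<omega>) = (1 - p) * measure (centred_normal 1) {x. \<theta> \<le> \<bar>x\<bar>}"
      using i p by (intro prob_null_and) auto
    also have "\<dots> \<le> 1 * measure (centred_normal 1) {x. \<theta> \<le> \<bar>x\<bar>}"
      using p by (intro mult_right_mono) auto
    finally have 1: "\<P>(\<omega> in M. rej i \<omega> \<and> \<not> \<nu> i \<omega>)
        \<le> measure (centred_normal 1) {x. \<theta> \<le> \<bar>x\<bar>} + prob (space M - G)" by simp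
    have "\<P>(\<omega> in M. \<not> rej i \<omega> \<and> \<nu> i \<omega>)
        \<le> prob ({\<omega> \<in> space M. X i \<omega> \<in> {x. \<bar>x\<bar> \<le> \<theta>'} \<and> \<nu> i \<omega>} \<union> (space M - G))"
      using alt[OF i] by (intro finite_measure_mono) auto
    also have "\<dots> \<le> \<P>(\<omega> in M. X i \<omega> \<in> {x. \<bar>x\<bar> \<le> \<theta>'} \<and> \<nu> i \<omega>) + prob (space M - G)"
      by (intro measure_Un_le) auto
    also have "\<P>(\<omega> in M. X i \<omega> \<in> {x. \<bar>x\<bar> \<le> \<theta>'} \<and> \<nu> i \<omega>) = p * measure (centred_normal (1 + \<psi>\<^sup>2)) {x. \<bar>x\<bar> \<le> \<theta>'}"
      using i p by (intro prob_alternative_and) auto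
    \<comment> \<open>The weights 1 - p and p cancel the denominators of the conditional
      probabilities, and each of the two errors pays once for the complement of
      \<open>G\<close>.\<close>
    finally show ?thesis
      using 1 p prob_signal[OF i p] by (simp add: cond_prob_def R_def)
  qed
  then have "bayes_risk M m p \<nu> rej \<le> (\<Sum>i = 1..m. R)"
    unfolding bayes_risk_def by (intro sum_mono)
  then show ?thesis by (simp add: R_def)
qed

lemma exceedance_count_deviation:
  fixes T l u :: real
  assumes m: "m \<ge> 1" and p: "0 < p" "p < 1"
  shows "\<P>(\<omega> in M. l * u \<le> l * (\<Sum>j = 1..m. of_bool (\<bar>X j \<omega>\<bar> > T)))
    \<le> exp ((exp l - 1) * ((1 - p) * measure (centred_normal 1) {x. T < \<bar>x\<bar>}
        + p * measure (centred_normal (1 + \<psi>\<^sup>2)) {x. T < \<bar>x\<bar>}) * real m - l * u)"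
proof -
  define Y :: "nat \<Rightarrow> 'a \<Rightarrow> real" where "Y j \<omega> = of_bool (\<bar>X j \<omega>\<bar> > T)" for j \<omega>
  \<comment> \<open>Independence is assumed for the pairs, so the exceedance indicator is written as
    a function of the pair.\<close>
  define h :: "bool \<times> real \<Rightarrow> real" where "h z = indicator {x. T < \<bar>x\<bar>} (snd z)" for z
  have h: "h \<in> borel_measurable (count_space UNIV \<Otimes>\<^sub>M borel)"
    unfolding h_def by measurable
  have "indep_vars (\<lambda>_. borel) (\<lambda>j \<omega>. h (\<nu> j \<omega>, X j \<omega>)) {1..m}"
    by (rule indep_vars_compose2[OF indep_pairs h])
  moreover have "(\<lambda>j \<omega>. h (\<nu> j \<omega>, X j \<omega>)) = Y"
    by (auto simp: fun_eq_iff h_def Y_def)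
  ultimately have ind: "indep_vars (\<lambda>_. borel) Y {1..m}" by simp
  have "expectation (Y j) = (1 - p) * measure (centred_normal 1) {x. T < \<bar>x\<bar>}
        + p * measure (centred_normal (1 + \<psi>\<^sup>2)) {x. T < \<bar>x\<bar>}" if j: "j \<in> {1..m}" for j
  proof -
    note [measurable] = measurable_X[OF j]
    have "expectation (Y j) = expectation (indicator {\<omega> \<in> space M. X j \<omega> \<in> {x. T < \<bar>x\<bar>}})"
      by (intro Bochner_Integration.integral_cong) (auto simp: Y_def)
    also have "\<dots> = \<P>(\<omega> in M. X j \<omega> \<in> {x. T < \<bar>x\<bar>})"
      by (subst Bochner_Integration.integral_indicator) (auto intro!: arg_cong[where f=prob])
    also have "\<dots> = (1 - p) * measure (centred_normal 1) {x. T < \<bar>x\<bar>}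
        + p * measure (centred_normal (1 + \<psi>\<^sup>2)) {x. T < \<bar>x\<bar>}"
      using j p by (intro prob_observation) auto
    finally show ?thesis .
  qed
  from chernoff_bernoulli_sum[OF _ ind _ this, of l u] show ?thesis
    by (simp add: Y_def)
qed

end

section \<open>Thresholds for rejection and acceptance\<close>

context one_group_prior
begin

lemma trunc_mean_pos: "s > 0 \<Longrightarrow> trunc_mean s > 0"
  unfolding trunc_mean_def using AE_prior_pos
  by (intro Q.expectation_greater integrable_trunc) (auto elim!: eventually_mono)

text \<open>The rejection inequality, weakened to the largest admissible scale \<open>T\<close> and
  solved for |x|, gives the threshold. Its Gaussian tail is at most (2 * trunc_mean s / D) /
  \<theta> with s = 1 / T^2, and \<theta> is at least of order sqrt (ln s), so the decay of
  \<open>trunc_mean\<close> makes it o(T).\<close>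

lemma null_rejection_threshold:
  assumes "(1/2 < a \<and> a < 1) \<or> (a = 1/2 \<and> ((\<lambda>t. L t / sqrt (ln t)) \<longlongrightarrow> 0) at_top)"
  obtains \<theta> :: "real \<Rightarrow> real"
  where "\<And>\<tau> T x. \<lbrakk>0 < \<tau>; \<tau> \<le> T; T \<le> 1; 1 - kappa_posterior_mean a L \<tau> x > 1/2\<rbrakk> \<Longrightarrow> \<theta> T \<le> \<bar>x\<bar>"
    and "((\<lambda>T. measure std_normal_distribution {x. \<theta> T \<le> \<bar>x\<bar>} / T) \<longlongrightarrow> 0) (at_right 0)"
proof -
  define D where "D = Q.expectation (\<lambda>t. sqrt (shrinkage 1 t))"
  have D: "D > 0"
    using expectation_shrinkage_lik_pos[of 1 0] by (simp add: shrinkage_lik_def[abs_def] D_def)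
  define \<theta> where "\<theta> T = sqrt (2 * ln (D / (2 * trunc_mean (1 / T\<^sup>2))))" for T
  show ?thesis
  proof (rule that[of \<theta>])
    fix \<tau> T x :: real
    assume \<tau>: "0 < \<tau>" "\<tau> \<le> T" "T \<le> 1" and rej: "1 - kappa_posterior_mean a L \<tau> x > 1/2"
    have M: "trunc_mean (1 / T\<^sup>2) > 0" using \<tau> by (intro trunc_mean_pos) simp
    have "1/2 < trunc_mean (1 / \<tau>\<^sup>2) * exp (x\<^sup>2 / 2) / D"
      unfolding D_def by (rule less_le_trans[OF rej one_minus_posterior_mean_le]) (use \<tau> in auto)
    also have "\<dots> \<le> trunc_mean (1 / T\<^sup>2) * exp (x\<^sup>2 / 2) / D"
      using \<tau> D by (intro divide_right_mono mult_right_mono trunc_mean_antimono divide_left_mono power_mono) auto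
    finally have "D / (2 * trunc_mean (1 / T\<^sup>2)) \<le> exp (x\<^sup>2 / 2)"
      using D M by (simp add: field_simps)
    moreover have "D / (2 * trunc_mean (1 / T\<^sup>2)) > 0" using D M by simp
    ultimately have "ln (D / (2 * trunc_mean (1 / T\<^sup>2))) \<le> ln (exp (x\<^sup>2 / 2))"
      by (simp only: ln_le_cancel_iff exp_gt_zero)
    then have "ln (D / (2 * trunc_mean (1 / T\<^sup>2))) \<le> x\<^sup>2 / 2" by simp
    \<comment> \<open>\<open>sqrt\<close> is monotone on all reals, so a negative logarithm inside
      \<theta> is covered.\<close>
    then have "\<theta> T \<le> sqrt (x\<^sup>2)" unfolding \<theta>_def by (intro real_sqrt_le_mono) simp
    then show "\<theta> T \<le> \<bar>x\<bar>" by simp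
  next
    define g where "g s = trunc_mean s * sqrt s / sqrt (ln s)" for s
    have g: "(g \<longlongrightarrow> 0) at_top" unfolding g_def by (rule trunc_mean_small[OF assms])
    have bound: "\<forall>\<^sub>F s in at_top. measure std_normal_distribution {x. \<theta> (1 / sqrt s) \<le> \<bar>x\<bar>} * sqrt s \<le> 4 / D * g s"
    proof -
      have "\<forall>\<^sub>F s in at_top. g s < 1" using order_tendstoD(2)[OF g, of 1] by simp
      \<comment> \<open>Combined with g s < 1 this yields ln (D / (2 * trunc_mean s)) \<ge> ln s /
        4, the lower bound for \<theta>; the exponent 1/4 is a convenient choice between 0 and
        1/2.\<close>
      moreover have "\<forall>\<^sub>F s::real in at_top. s powr (1/4) \<le> D / 2 * (sqrt s / sqrt (ln s))"
        using D by real_asymp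
      ultimately show ?thesis using eventually_gt_at_top[of 1]
      proof eventually_elim
        case (elim s)
        have s: "s > 1" by fact
        then have ln_s: "ln s > 0" by simp
        have M: "trunc_mean s > 0" using s by (intro trunc_mean_pos) simp
        have "s powr (1/4) \<le> D / 2 * (sqrt s / sqrt (ln s))" by fact
        also have "\<dots> \<le> D / 2 * (1 / trunc_mean s)"
        proof (rule mult_left_mono)
          have "trunc_mean s * (sqrt s / sqrt (ln s)) \<le> 1" using elim(1) by (simp add: g_def)
          then show "sqrt s / sqrt (ln s) \<le> 1 / trunc_mean s" using M by (simp add: pos_le_divide_eq mult.commute)
        qed (use D in simp)
        also have "\<dots> = D / (2 * trunc_mean s)" by simp
        finally have "ln (s powr (1/4)) \<le> ln (D / (2 * trunc_mean s))"
          using s M D by (subst ln_le_cancel_iff) auto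
        then have ln_ge: "ln s / 4 \<le> ln (D / (2 * trunc_mean s))" using s by (simp add: ln_powr)
        have inv: "1 / (1 / sqrt s)\<^sup>2 = s" using s by (simp add: power_divide)
        have \<theta>_eq: "\<theta> (1 / sqrt s) = sqrt (2 * ln (D / (2 * trunc_mean s)))"
          unfolding \<theta>_def inv ..
        have "sqrt (ln s) / 2 = sqrt (ln s / 4)" by (simp add: real_sqrt_divide)
        also have "\<dots> \<le> \<theta> (1 / sqrt s)"
          unfolding \<theta>_eq using ln_ge ln_s by (intro real_sqrt_le_mono) linarith
        finally have \<theta>_ge: "sqrt (ln s) / 2 \<le> \<theta> (1 / sqrt s)" .
        moreover have "sqrt (ln s) > 0" using ln_s by simp
        ultimately have \<theta>_pos: "\<theta> (1 / sqrt s) > 0" by linarith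
        have "(\<theta> (1 / sqrt s))\<^sup>2 / 2 = ln (D / (2 * trunc_mean s))"
          unfolding \<theta>_eq using ln_ge ln_s by simp
        then have exp_eq: "exp (- (\<theta> (1 / sqrt s))\<^sup>2 / 2) = 2 * trunc_mean s / D"
          using D M by (simp add: exp_minus)
        have "measure std_normal_distribution {x. \<theta> (1 / sqrt s) \<le> \<bar>x\<bar>}
            \<le> exp (- (\<theta> (1 / sqrt s))\<^sup>2 / 2) / \<theta> (1 / sqrt s)"
          by (rule measure_std_normal_tail_le[OF \<theta>_pos])
        also have "\<dots> \<le> exp (- (\<theta> (1 / sqrt s))\<^sup>2 / 2) / (sqrt (ln s) / 2)"
          using \<theta>_ge \<theta>_pos ln_s by (intro divide_left_mono) auto
        also have "\<dots> = 4 / D * trunc_mean s / sqrt (ln s)"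
          unfolding exp_eq by simp
        finally have "measure std_normal_distribution {x. \<theta> (1 / sqrt s) \<le> \<bar>x\<bar>} * sqrt s
            \<le> 4 / D * trunc_mean s / sqrt (ln s) * sqrt s"
          using s by (intro mult_right_mono) auto
        then show ?case by (simp add: g_def)
      qed
    qed
    have lim_g: "((\<lambda>s. 4 / D * g s) \<longlongrightarrow> 0) at_top"
      using tendsto_mult[OF tendsto_const g, of "4 / D"] by simp
    have lim: "((\<lambda>s. measure std_normal_distribution {x. \<theta> (1 / sqrt s) \<le> \<bar>x\<bar>} * sqrt s) \<longlongrightarrow> 0) at_top"
    proof (rule tendsto_sandwich[OF _ bound tendsto_const lim_g])
      show "\<forall>\<^sub>F s in at_top. 0 \<le> measure std_normal_distribution {x. \<theta> (1 / sqrt s) \<le> \<bar>x\<bar>} * sqrt s"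
        using eventually_ge_at_top[of 0] by eventually_elim simp
    qed
    have "filterlim (\<lambda>T::real. 1 / T\<^sup>2) at_top (at_right 0)" by real_asymp
    from filterlim_compose[OF lim this]
    have "((\<lambda>T. measure std_normal_distribution {x. \<theta> (1 / sqrt (1 / T\<^sup>2)) \<le> \<bar>x\<bar>} * sqrt (1 / T\<^sup>2)) \<longlongrightarrow> 0) (at_right 0)" .
    moreover have "\<forall>\<^sub>F T in at_right (0::real). measure std_normal_distribution {x. \<theta> (1 / sqrt (1 / T\<^sup>2)) \<le> \<bar>x\<bar>} * sqrt (1 / T\<^sup>2)
        = measure std_normal_distribution {x. \<theta> T \<le> \<bar>x\<bar>} / T"
      using eventually_at_right_less[of 0] by eventually_elim (simp add: real_sqrt_divide)
    ultimately show "((\<lambda>T. measure std_normal_distribution {x. \<theta> T \<le> \<bar>x\<bar>} / T) \<longlongrightarrow> 0) (at_right 0)"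
      by (rule Lim_transform_eventually)
  qed
qed

text \<open>Acceptance forces the bound of \<open>posterior_mean_le\<close> up to 1/2, and as \<eta>
  < 1/2 this can be solved for x^2. The second scale \<open>\<tau>'\<close> lets a deterministic
  lower bound replace the random \<tau> inside the logarithm.\<close>

lemma non_rejection_threshold:
  assumes \<eta>: "0 < \<eta>" "\<eta> < 1/2" and d: "0 < d" "d < 1" and b: "a < b"
  obtains k T where "T > 0"
    "\<And>\<tau>' \<tau> x. \<lbrakk>0 < \<tau>'; \<tau>' \<le> \<tau>; \<tau> \<le> T; kappa_posterior_mean a L \<tau> x \<ge> 1/2\<rbrakk> \<Longrightarrow>
       x\<^sup>2 \<le> (4 * b * ln (1 / \<tau>') + k) / (\<eta> * (1 - d))"
proof -
  obtain C s0 where C: "C > 0" "s0 \<ge> 1" and bound: "\<And>\<tau> x. \<lbrakk>\<tau> > 0; s0 \<le> 1 / \<tau>\<^sup>2\<rbrakk> \<Longrightarrow>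
       kappa_posterior_mean a L \<tau> x \<le> \<eta> + C * (1 / \<tau>\<^sup>2) powr b * exp (- \<eta> * (1 - d) * x\<^sup>2 / 2)"
    using posterior_mean_le[OF \<eta>(1) _ d b] \<eta> by auto
  show ?thesis
  proof (rule that[of "1 / sqrt s0" "2 * ln (C / (1/2 - \<eta>))"])
    fix \<tau>' \<tau> x :: real
    assume \<tau>: "0 < \<tau>'" "\<tau>' \<le> \<tau>" "\<tau> \<le> 1 / sqrt s0" and acc: "kappa_posterior_mean a L \<tau> x \<ge> 1/2"
    have \<tau>_pos: "\<tau> > 0" using \<tau> by simp
    have "\<tau>\<^sup>2 \<le> (1 / sqrt s0)\<^sup>2" using \<tau> by (intro power_mono) auto
    also have "\<dots> = 1 / s0" using C by (simp add: power_divide)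
    finally have "s0 \<le> 1 / \<tau>\<^sup>2" using \<tau>_pos C by (simp add: field_simps)
    from bound[OF \<tau>_pos this, of x] acc
    have "1/2 - \<eta> \<le> C * (1 / \<tau>\<^sup>2) powr b * exp (- (\<eta> * (1 - d) * x\<^sup>2 / 2))"
      by simp
    then have "exp (\<eta> * (1 - d) * x\<^sup>2 / 2) \<le> C / (1/2 - \<eta>) * (1 / \<tau>\<^sup>2) powr b"
      using \<eta> by (simp add: exp_minus field_simps)
    moreover have "C / (1/2 - \<eta>) * (1 / \<tau>\<^sup>2) powr b > 0"
      using C \<eta> \<tau>_pos by (intro mult_pos_pos) auto
    ultimately have "\<eta> * (1 - d) * x\<^sup>2 / 2 \<le> ln (C / (1/2 - \<eta>) * (1 / \<tau>\<^sup>2) powr b)"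
      by (simp only: ln_ge_iff)
    also have "\<dots> = ln (C / (1/2 - \<eta>)) + ln ((1 / \<tau>\<^sup>2) powr b)"
      using C \<eta> \<tau>_pos by (intro ln_mult_pos) auto
    also have "ln ((1 / \<tau>\<^sup>2) powr b) = 2 * b * ln (1 / \<tau>)"
      using \<tau>_pos by (simp add: ln_powr ln_div ln_realpow)
    also have "2 * b * ln (1 / \<tau>) \<le> 2 * b * ln (1 / \<tau>')"
      using \<tau> \<tau>_pos b a_pos by (intro mult_left_mono) (auto simp: ln_div)
    finally have "\<eta> * (1 - d) * x\<^sup>2 \<le> 4 * b * ln (1 / \<tau>') + 2 * ln (C / (1/2 - \<eta>))"
      by simp
    then show "x\<^sup>2 \<le> (4 * b * ln (1 / \<tau>') + 2 * ln (C / (1/2 - \<eta>))) / (\<eta> * (1 - d))"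
      using \<eta> d by (simp add: field_simps)
  qed (use C in auto)
qed

end

section \<open>Asymptotics of the Bayes risk\<close>

text \<open>The floor 1 / m is absorbed by B * p because B * m * p \<ge> 1. The constant c2 \<ge> 1
  weakens the lower bound and is dropped from the upper one.\<close>

lemma tau_hat_bounds:
  assumes "m \<ge> 1" "c2 \<ge> 1" "1 \<le> B * (real m * p)"
    and S: "S = (\<Sum>j = 1..m. of_bool (\<bar>x j\<bar> > sqrt (c1 * ln (real m))))"
    and "A * (real m * p) < S" "S < B * (real m * p)"
  shows "A / c2 * p \<le> tau_hat c1 c2 m x" "tau_hat c1 c2 m x \<le> B * p"
proof -
  have \<tau>: "tau_hat c1 c2 m x = max (1 / real m) (1 / (c2 * real m) * S)"
    unfolding tau_hat_def S ..
  have "A / c2 * p = 1 / (c2 * real m) * (A * (real m * p))" using assms by (simp add: field_simps)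
  also have "\<dots> \<le> 1 / (c2 * real m) * S" using assms by (intro mult_left_mono) auto
  finally show "A / c2 * p \<le> tau_hat c1 c2 m x" by (simp add: \<tau>)
  have "1 / real m \<le> B * p" using assms by (simp add: field_simps)
  moreover have "1 / (c2 * real m) * S \<le> B * p"
  proof -
    have "S \<ge> 0" unfolding S by (intro sum_nonneg) auto
    then have "1 / (c2 * real m) * S \<le> 1 / (1 * real m) * S"
      using assms by (intro mult_right_mono divide_left_mono mult_right_mono) auto
    also have "\<dots> \<le> B * p" using assms by (simp add: field_simps)
    finally show ?thesis .
  qed
  ultimately show "tau_hat c1 c2 m x \<le> B * p" by (simp add: \<tau>)
qed

context two_groups
begin

text \<open>The exceedance probability lies between \<gamma> * p and 2 * p. With l = 1 and exp 1
  \<le> 3 the Chernoff exponent is at most (4 - 5) * m * p; with l = - 1 and exp (- 1) \<le> 2/5 it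
  is at most (1/2 - 3/5) * \<gamma> * m * p.\<close>

lemma exceedance_count_concentration:
  fixes T \<gamma> :: real
  defines "S \<equiv> \<lambda>\<omega>. \<Sum>j = 1..m. of_bool (\<bar>X j \<omega>\<bar> > T) :: real"
  assumes m: "m \<ge> 1" and p: "0 < p" "p < 1" and \<gamma>: "0 < \<gamma>"
    and null: "measure (centred_normal 1) {x. T < \<bar>x\<bar>} \<le> p"
    and alt: "\<gamma> \<le> measure (centred_normal (1 + \<psi>\<^sup>2)) {x. T < \<bar>x\<bar>}"
  defines "G \<equiv> {\<omega> \<in> space M. \<gamma> / 2 * (real m * p) < S \<omega> \<and> S \<omega> < 5 * (real m * p)}"
  shows "G \<in> events" "prob (space M - G) \<le> exp (- (real m * p)) + exp (- \<gamma> / 10 * (real m * p))"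
proof -
  have [measurable]: "S \<in> borel_measurable M"
  proof -
    have "(\<lambda>\<omega>. \<Sum>j = 1..m. indicator {x. T < \<bar>x\<bar>} (X j \<omega>) :: real) \<in> borel_measurable M"
      using measurable_X by (intro borel_measurable_sum measurable_compose[OF _ borel_measurable_indicator]) auto
    then show ?thesis unfolding S_def by (simp add: indicator_def)
  qed
  show "G \<in> events" unfolding G_def by measurable
  define q where "q = (1 - p) * measure (centred_normal 1) {x. T < \<bar>x\<bar>}
        + p * measure (centred_normal (1 + \<psi>\<^sup>2)) {x. T < \<bar>x\<bar>}"
  have pos: "1 + \<psi>\<^sup>2 > 0" by (simp add: add_pos_nonneg)
  have prob_space: "prob_space (centred_normal (1 + \<psi>\<^sup>2))"
    unfolding centred_normal_def using pos by (intro prob_space_normal_density) simp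
  have "(1 - p) * measure (centred_normal 1) {x. T < \<bar>x\<bar>} \<le> 1 * p"
    using null p by (intro mult_mono) auto
  moreover have "p * measure (centred_normal (1 + \<psi>\<^sup>2)) {x. T < \<bar>x\<bar>} \<le> p * 1"
    using p prob_space.prob_le_1[OF prob_space] by (intro mult_left_mono) auto
  ultimately have q_le: "q \<le> 2 * p" by (simp add: q_def)
  have "0 \<le> (1 - p) * measure (centred_normal 1) {x. T < \<bar>x\<bar>}" using p by simp
  moreover have "p * \<gamma> \<le> p * measure (centred_normal (1 + \<psi>\<^sup>2)) {x. T < \<bar>x\<bar>}"
    using p alt by (intro mult_left_mono) auto
  ultimately have q_ge: "\<gamma> * p \<le> q" by (simp add: q_def mult.commute)
  have "0 \<le> \<gamma> * p" using \<gamma> p by simp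
  then have q_nonneg: "0 \<le> q" using q_ge by linarith
  have "\<P>(\<omega> in M. 1 * (5 * (real m * p)) \<le> 1 * S \<omega>) \<le> exp ((exp 1 - 1) * q * real m - 1 * (5 * (real m * p)))"
    using exceedance_count_deviation[OF m p, of 1 "5 * (real m * p)" T] by (simp add: S_def q_def)
  also have "\<dots> \<le> exp (- (real m * p))"
  proof -
    have "(exp 1 - 1) * q \<le> 2 * (2 * p)"
      using exp_le q_le q_nonneg by (intro mult_mono) auto
    then have "(exp 1 - 1) * q * real m \<le> 2 * (2 * p) * real m" by (intro mult_right_mono) auto
    then show ?thesis by simp
  qed
  finally have up: "\<P>(\<omega> in M. 5 * (real m * p) \<le> S \<omega>) \<le> exp (- (real m * p))" by simp
  have "\<P>(\<omega> in M. (- 1) * (\<gamma> / 2 * (real m * p)) \<le> (- 1) * S \<omega>)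
      \<le> exp ((exp (- 1) - 1) * q * real m - (- 1) * (\<gamma> / 2 * (real m * p)))"
    using exceedance_count_deviation[OF m p, of "- 1" "\<gamma> / 2 * (real m * p)" T] by (simp add: S_def q_def)
  also have "\<dots> \<le> exp (- \<gamma> / 10 * (real m * p))"
  proof -
    have "(5/2 :: real) \<le> exp 1" using exp_lower_Taylor_quadratic[of "1::real"] by simp
    then have e: "exp (- 1 :: real) \<le> 2/5" by (simp add: exp_minus field_simps)
    have "(3/5) * (\<gamma> * p) \<le> (1 - exp (- 1)) * q"
      using e q_ge q_nonneg \<gamma> p by (intro mult_mono) auto
    then have "(3/5) * (\<gamma> * p) * real m \<le> (1 - exp (- 1)) * q * real m" by (intro mult_right_mono) auto
    then show ?thesis by (simp add: algebra_simps)
  qed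
  finally have low: "\<P>(\<omega> in M. S \<omega> \<le> \<gamma> / 2 * (real m * p)) \<le> exp (- \<gamma> / 10 * (real m * p))" by simp
  have "prob (space M - G) \<le> prob ({\<omega> \<in> space M. 5 * (real m * p) \<le> S \<omega>} \<union> {\<omega> \<in> space M. S \<omega> \<le> \<gamma> / 2 * (real m * p)})"
    by (intro finite_measure_mono) (auto simp: G_def)
  also have "\<dots> \<le> \<P>(\<omega> in M. 5 * (real m * p) \<le> S \<omega>) + \<P>(\<omega> in M. S \<omega> \<le> \<gamma> / 2 * (real m * p))"
    by (intro measure_Un_le) auto
  finally show "prob (space M - G) \<le> exp (- (real m * p)) + exp (- \<gamma> / 10 * (real m * p))"
    using up low by simp
qed

end

lemma null_exceedance_le:
  assumes "c1 \<ge> 2" and m: "ln (real m) \<ge> 1"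
  shows "measure (centred_normal 1) {x. sqrt (c1 * ln (real m)) < \<bar>x\<bar>} \<le> 1 / real m"
proof -
  interpret N: prob_space std_normal_distribution
    by (rule prob_space_normal_density) simp
  define T where "T = sqrt (c1 * ln (real m))"
  have m_pos: "real m > 0" using m by (cases "m = 0") auto
  have le: "2 * ln (real m) \<le> c1 * ln (real m)" using assms by (intro mult_right_mono) auto
  have "1 \<le> c1 * ln (real m)" using le m by linarith
  then have T: "1 \<le> T" "T\<^sup>2 = c1 * ln (real m)" by (auto simp: T_def)
  have "measure (centred_normal 1) {x. T < \<bar>x\<bar>} \<le> measure std_normal_distribution {x. T \<le> \<bar>x\<bar>}"
    unfolding centred_normal_1 by (intro N.finite_measure_mono) auto
  also have "\<dots> \<le> exp (- T\<^sup>2 / 2) / T" using T by (intro measure_std_normal_tail_le) simp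
  also have "\<dots> \<le> exp (- T\<^sup>2 / 2) / 1" using T by (intro divide_left_mono) auto
  also have "\<dots> \<le> exp (- ln (real m))" using T le by simp
  also have "\<dots> = 1 / real m" using m_pos by (simp add: exp_minus inverse_eq_divide)
  finally show ?thesis by (simp add: T_def)
qed

text \<open>After division by sqrt s the observation is standard normal and the threshold at most
  \<open>R\<close>.\<close>

lemma alternative_exceedance_ge:
  assumes T: "T \<le> sqrt s * R" and s: "s > 0"
  shows "measure std_normal_distribution {x. R < \<bar>x\<bar>} \<le> measure (centred_normal s) {x. T < \<bar>x\<bar>}"
proof -
  interpret N: prob_space std_normal_distribution
    by (rule prob_space_normal_density) simp
  have "measure (centred_normal s) {x. T < \<bar>x\<bar>} = measure std_normal_distribution {x. T < \<bar>sqrt s * x\<bar>}"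
    unfolding centred_normal_eq_distr[OF s]
    by (subst measure_distr) (auto intro!: arg_cong[where f="measure _"])
  moreover have "measure std_normal_distribution {x. R < \<bar>x\<bar>} \<le> measure std_normal_distribution {x. T < \<bar>sqrt s * x\<bar>}"
  proof (intro N.finite_measure_mono subsetI CollectI)
    fix x assume "x \<in> {x. R < \<bar>x\<bar>}"
    then have "sqrt s * R < sqrt s * \<bar>x\<bar>" using s by simp
    moreover have "\<bar>sqrt s * x\<bar> = sqrt s * \<bar>x\<bar>" using s by (simp add: abs_mult)
    ultimately show "T < \<bar>sqrt s * x\<bar>" using T by linarith
  qed auto
  ultimately show ?thesis by simp
qed

text \<open>ln v = ln (\<psi>^2) + 2 * ln (1 - p) + 2 * ln (1 / p), where the first two terms are
  o(\<psi>^2).\<close>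

lemma log_signal_ratio:
  fixes p \<psi> v :: "nat \<Rightarrow> real"
  assumes p_range: "\<And>m. m \<ge> 1 \<Longrightarrow> 0 < p m \<and> p m < 1"
    and v_eq: "\<And>m. m \<ge> 1 \<Longrightarrow> v m = (\<psi> m)\<^sup>2 * ((1 - p m) / p m)\<^sup>2"
    and p_lim: "p \<longlonglongrightarrow> 0"
    and psi_lim: "filterlim (\<lambda>m. (\<psi> m)\<^sup>2) at_top sequentially"
    and C_lim: "(\<lambda>m. ln (v m) / (\<psi> m)\<^sup>2) \<longlonglongrightarrow> C"
  shows "(\<lambda>m. ln (1 / p m) / (\<psi> m)\<^sup>2) \<longlonglongrightarrow> C / 2"
proof -
  have "((\<lambda>y::real. ln y / y) \<longlongrightarrow> 0) at_top" by real_asymp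
  from filterlim_compose[OF this psi_lim]
  have 1: "(\<lambda>m. ln ((\<psi> m)\<^sup>2) / (\<psi> m)\<^sup>2) \<longlonglongrightarrow> 0" .
  have inv: "(\<lambda>m. inverse ((\<psi> m)\<^sup>2)) \<longlonglongrightarrow> 0"
    by (rule filterlim_compose[OF tendsto_inverse_0_at_top[OF filterlim_ident] psi_lim])
  have "(\<lambda>m. ln (1 - p m)) \<longlonglongrightarrow> ln (1 - 0)" by (intro tendsto_intros p_lim) auto
  from tendsto_mult[OF this inv] have 2: "(\<lambda>m. ln (1 - p m) / (\<psi> m)\<^sup>2) \<longlonglongrightarrow> 0"
    by (simp add: divide_inverse)
  have "(\<lambda>m. (ln (v m) / (\<psi> m)\<^sup>2 - ln ((\<psi> m)\<^sup>2) / (\<psi> m)\<^sup>2 - 2 * (ln (1 - p m) / (\<psi> m)\<^sup>2)) / 2) \<longlonglongrightarrow> (C - 0 - 2 * 0) / 2"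
    by (intro tendsto_intros C_lim 1 2) auto
  moreover have "\<forall>\<^sub>F m in sequentially. (ln (v m) / (\<psi> m)\<^sup>2 - ln ((\<psi> m)\<^sup>2) / (\<psi> m)\<^sup>2 - 2 * (ln (1 - p m) / (\<psi> m)\<^sup>2)) / 2
      = ln (1 / p m) / (\<psi> m)\<^sup>2"
    using eventually_ge_at_top[of 1] filterlim_at_top_dense[THEN iffD1, OF psi_lim, rule_format, of 0]
  proof eventually_elim
    case (elim m)
    note p = p_range[OF elim(1)]
    have "ln (v m) = ln ((\<psi> m)\<^sup>2) + ln (((1 - p m) / p m)\<^sup>2)"
      unfolding v_eq[OF elim(1)] using elim p by (intro ln_mult_pos) auto
    also have "ln (((1 - p m) / p m)\<^sup>2) = 2 * ln ((1 - p m) / p m)"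
      using p by (subst ln_realpow) auto
    also have "ln ((1 - p m) / p m) = ln (1 - p m) + ln (1 / p m)"
      using p by (simp add: ln_div)
    finally show ?case using elim by (simp add: field_simps)
  qed
  ultimately have "(\<lambda>m. ln (1 / p m) / (\<psi> m)\<^sup>2) \<longlonglongrightarrow> (C - 0 - 2 * 0) / 2"
    by (rule Lim_transform_eventually)
  then show ?thesis by simp
qed

theorem theorem3p2:
  fixes M :: "nat \<Rightarrow> 'a measure"
    and \<nu> :: "nat \<Rightarrow> nat \<Rightarrow> 'a \<Rightarrow> bool"
    and X :: "nat \<Rightarrow> nat \<Rightarrow> 'a \<Rightarrow> real"
    and p \<psi> v :: "nat \<Rightarrow> real"
    and C \<epsilon> c1 c2 a K \<eta> \<delta> :: real
    and L :: "real \<Rightarrow> real"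
  assumes model: "\<And>m. m \<ge> 1 \<Longrightarrow> two_groups (M m) m (p m) (\<psi> m) (\<nu> m) (X m)"
    and p_range: "\<And>m. m \<ge> 1 \<Longrightarrow> 0 < p m \<and> p m < 1"
    and psi_pos: "\<And>m. m \<ge> 1 \<Longrightarrow> (\<psi> m)\<^sup>2 > 0"
    and v_eq: "\<And>m. m \<ge> 1 \<Longrightarrow> v m = (\<psi> m)\<^sup>2 * ((1 - p m) / p m)\<^sup>2"
    and p_lim: "p \<longlonglongrightarrow> 0"
    and psi_lim: "filterlim (\<lambda>m. (\<psi> m)\<^sup>2) at_top sequentially"
    and v_lim: "filterlim v at_top sequentially"
    and C_pos: "C > 0"
    and C_lim: "(\<lambda>m. ln (v m) / (\<psi> m)\<^sup>2) \<longlonglongrightarrow> C"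
    and eps_range: "0 < \<epsilon>" "\<epsilon> < 1"
    and p_prop: "\<exists>c>0. \<forall>m\<ge>1. p m = c * real m powr (- \<epsilon>)"
    and c1_ge: "c1 \<ge> 2"
    and c2_ge: "c2 \<ge> 1"
    and prior: "one_group_prior a K L"
    and a_cases: "(1/2 < a \<and> a < 1) \<or> (a = 1/2 \<and> ((\<lambda>t. L t / sqrt (ln t)) \<longlongrightarrow> 0) at_top)"
    and eta_range: "0 < \<eta>" "\<eta> < 1/2"
    and delta_range: "0 < \<delta>" "\<delta> < 1"
  shows "\<exists>r :: nat \<Rightarrow> real. r \<longlonglongrightarrow> 0 \<and>
    (\<forall>\<^sub>F m in sequentially.
       bayes_risk (M m) m (p m) (\<nu> m) (\<lambda>i \<omega>. eb_rejects a L c1 c2 m (\<lambda>j. X m j \<omega>) i)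
         \<le> real m * p m * (2 * \<Phi> (sqrt (2 * a * C / (\<eta> * (1 - \<delta>)))) - 1) * (1 + r m))"
proof -
  interpret one_group_prior a K L by (rule prior)
  obtain c where c: "c > 0" "\<And>m. m \<ge> 1 \<Longrightarrow> p m = c * real m powr (- \<epsilon>)" using p_prop by blast
  define Q where "Q = sqrt (2 * a * C / (\<eta> * (1 - \<delta>)))"
  have Q2: "Q\<^sup>2 = 2 * a * C / (\<eta> * (1 - \<delta>))" and Q_pos: "Q > 0"
    using a_pos C_pos eta_range delta_range by (auto simp: Q_def)
  define P0 where "P0 = 2 * \<Phi> Q - 1"
  have P0: "P0 > 0" unfolding P0_def by (rule two_Phi_minus_one_pos[OF Q_pos])

  \<comment> \<open>Exponents strictly inside the target constant\<close>
  define d where "d = \<delta> / 2"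
  have d: "0 < d" "d < 1" "1 - \<delta> < 1 - d" using delta_range by (auto simp: d_def)
  have "a * 1 < a * ((1 - d) / (1 - \<delta>))" using a_pos delta_range d by (intro mult_strict_left_mono) auto
  then obtain b where b: "a < b" "b < a * ((1 - d) / (1 - \<delta>))" using dense by auto
  \<comment> \<open>The left side is the limit of the acceptance bound for x^2 divided by \<psi>^2.
    Being strictly below Q^2, it leaves room for all additive constants.\<close>
  have slope: "4 * b * (C / 2) / (\<eta> * (1 - d)) < Q\<^sup>2"
  proof -
    have "b / (1 - d) < a / (1 - \<delta>)" using b(2) d delta_range by (simp add: field_simps)
    then have "2 * C / \<eta> * (b / (1 - d)) < 2 * C / \<eta> * (a / (1 - \<delta>))"
      using C_pos eta_range by (intro mult_strict_left_mono) auto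
    then show ?thesis unfolding Q2 by (simp add: mult_ac)
  qed

  \<comment> \<open>Thresholds supplied by the prior\<close>
  obtain \<theta> where \<theta>: "\<And>\<tau> T x. \<lbrakk>0 < \<tau>; \<tau> \<le> T; T \<le> 1; 1 - kappa_posterior_mean a L \<tau> x > 1/2\<rbrakk> \<Longrightarrow> \<theta> T \<le> \<bar>x\<bar>"
    and \<theta>_lim: "((\<lambda>T. measure std_normal_distribution {x. \<theta> T \<le> \<bar>x\<bar>} / T) \<longlongrightarrow> 0) (at_right 0)"
    by (rule null_rejection_threshold[OF a_cases]) (rule that, blast+)
  obtain k T0 where T0: "T0 > 0" and accept: "\<And>\<tau>' \<tau> x. \<lbrakk>0 < \<tau>'; \<tau>' \<le> \<tau>; \<tau> \<le> T0; kappa_posterior_mean a L \<tau> x \<ge> 1/2\<rbrakk> \<Longrightarrow>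
       x\<^sup>2 \<le> (4 * b * ln (1 / \<tau>') + k) / (\<eta> * (1 - d))"
    by (rule non_rejection_threshold[OF eta_range d(1,2) b(1)]) (rule that, blast+)

  \<comment> \<open>Growth of ln (1 / p) and ln m against \<psi>^2\<close>
  have lnp: "(\<lambda>m. ln (1 / p m) / (\<psi> m)\<^sup>2) \<longlonglongrightarrow> C / 2"
    by (rule log_signal_ratio[OF p_range v_eq p_lim psi_lim C_lim])
  have inv_psi: "(\<lambda>m. inverse ((\<psi> m)\<^sup>2)) \<longlonglongrightarrow> 0"
    by (rule filterlim_compose[OF tendsto_inverse_0_at_top[OF filterlim_ident] psi_lim])
  \<comment> \<open>Logarithms in p = c * m powr (- \<epsilon>) express ln m through ln (1 /
    p).\<close>
  have lnm: "(\<lambda>m. ln (real m) / (\<psi> m)\<^sup>2) \<longlonglongrightarrow> C / (2 * \<epsilon>)"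
  proof -
    have "(\<lambda>m. (ln (1 / p m) / (\<psi> m)\<^sup>2 + ln c * inverse ((\<psi> m)\<^sup>2)) / \<epsilon>) \<longlonglongrightarrow> (C / 2 + ln c * 0) / \<epsilon>"
      using eps_range by (intro tendsto_intros lnp inv_psi) auto
    moreover have "\<forall>\<^sub>F m in sequentially. (ln (1 / p m) / (\<psi> m)\<^sup>2 + ln c * inverse ((\<psi> m)\<^sup>2)) / \<epsilon> = ln (real m) / (\<psi> m)\<^sup>2"
      using eventually_ge_at_top[of 1]
    proof eventually_elim
      case (elim m)
      have "ln (p m) = ln c + ln (real m powr (- \<epsilon>))"
        unfolding c(2)[OF elim] using c(1) elim by (intro ln_mult_pos) auto
      also have "\<dots> = ln c - \<epsilon> * ln (real m)" using elim by (simp add: ln_powr)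
      finally have "ln (1 / p m) + ln c = \<epsilon> * ln (real m)" using p_range[OF elim] by (simp add: ln_div)
      moreover have "(ln (1 / p m) / (\<psi> m)\<^sup>2 + ln c * inverse ((\<psi> m)\<^sup>2)) / \<epsilon> = (ln (1 / p m) + ln c) / (\<epsilon> * (\<psi> m)\<^sup>2)"
        by (simp add: divide_inverse algebra_simps)
      ultimately show ?case using eps_range by simp
    qed
    ultimately have "(\<lambda>m. ln (real m) / (\<psi> m)\<^sup>2) \<longlonglongrightarrow> (C / 2 + ln c * 0) / \<epsilon>"
      by (rule Lim_transform_eventually)
    then show ?thesis by simp
  qed

  \<comment> \<open>Constants for the scale estimator and error terms\<close>
  define R where "R = sqrt (c1 * (C / (2 * \<epsilon>) + 1))"
  \<comment> \<open>For large m the counting threshold sqrt (c1 * ln m) is at most \<open>R\<close>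
    in units of sqrt (1 + \<psi>^2), the + 1 in \<open>R\<close> being slack over the limit. So
    \<gamma> bounds from below the chance that a signal is counted.\<close>
  define \<gamma> where "\<gamma> = measure std_normal_distribution {x. R < \<bar>x\<bar>}"
  have \<gamma>: "\<gamma> > 0"
  proof -
    have "emeasure lborel {R<..R + 1} \<le> emeasure lborel {x. R < \<bar>x\<bar>}" by (intro emeasure_mono) auto
    then have "emeasure lborel {x. R < \<bar>x\<bar>} \<noteq> 0" by auto
    then show ?thesis unfolding \<gamma>_def by (intro measure_std_normal_pos) auto
  qed
  \<comment> \<open>The constant in the lower bound \<open>\<gamma>' * p m\<close> for
    \<open>tau_hat\<close> on the good event.\<close>
  define \<gamma>' where "\<gamma>' = \<gamma> / 2 / c2"
  have \<gamma>': "\<gamma>' > 0" using \<gamma> c2_ge by (simp add: \<gamma>'_def)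

  define err where "err m = exp (- (real m * p m)) + exp (- \<gamma> / 10 * (real m * p m))" for m
  \<comment> \<open>5 * p is the upper bound for \<open>tau_hat\<close> on the good event.\<close>
  define N where "N m = measure std_normal_distribution {x. \<theta> (5 * p m) \<le> \<bar>x\<bar>}" for m
  \<comment> \<open>Chosen so that m * p * P0 * (1 + r) equals m * (N + p * P0 + 2 * err); the terms
    \<open>N\<close> and \<open>err\<close> thus have to be o(p).\<close>
  define r where "r m = (N m / p m + 2 * (err m / p m)) / P0" for m

  have mp: "filterlim (\<lambda>m. real m * p m) at_top sequentially"
  proof -
    have "filterlim (\<lambda>m. real m * (c * real m powr (- \<epsilon>))) at_top sequentially"
      using c(1) eps_range by real_asymp
    moreover have "\<forall>\<^sub>F m in sequentially. real m * p m = real m * (c * real m powr (- \<epsilon>))"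
      using eventually_ge_at_top[of 1] by eventually_elim (simp add: c(2))
    ultimately show ?thesis
      by (simp only: filterlim_cong[OF refl refl])
  qed

  \<comment> \<open>Vanishing of the relative error\<close>
  have "r \<longlonglongrightarrow> 0"
  proof -
    have "filterlim (\<lambda>m. 5 * p m) (at_right 0) sequentially"
    proof -
      have "(\<lambda>m. 5 * p m) \<longlonglongrightarrow> 0" using tendsto_mult[OF tendsto_const p_lim, of 5] by simp
      moreover have "\<forall>\<^sub>F m in sequentially. 5 * p m > 0"
        using eventually_ge_at_top[of 1] by eventually_elim (use p_range in auto)
      ultimately show ?thesis by (rule tendsto_imp_filterlim_at_right)
    qed
    from filterlim_compose[OF \<theta>_lim this]
    have "(\<lambda>m. 5 * (N m / (5 * p m))) \<longlonglongrightarrow> 5 * 0" unfolding N_def by (intro tendsto_intros)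
    then have 1: "(\<lambda>m. N m / p m) \<longlonglongrightarrow> 0" by simp
    \<comment> \<open>As \<epsilon> < 1, m * p grows like a positive power of m, and its exponential
      beats the polynomial growth of 1 / p.\<close>
    have exp_lim: "(\<lambda>m. exp (- (g * (real m * p m))) / p m) \<longlonglongrightarrow> 0" if "g > 0" for g
    proof -
      have "(\<lambda>m. exp (- (g * (real m * (c * real m powr (- \<epsilon>))))) / (c * real m powr (- \<epsilon>))) \<longlonglongrightarrow> 0"
        using that c(1) eps_range by real_asymp
      moreover have "\<forall>\<^sub>F m in sequentially. exp (- (g * (real m * (c * real m powr (- \<epsilon>))))) / (c * real m powr (- \<epsilon>))
          = exp (- (g * (real m * p m))) / p m"
        using eventually_ge_at_top[of 1] by eventually_elim (simp add: c(2))
      ultimately show ?thesis by (rule Lim_transform_eventually)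
    qed
    have 2: "(\<lambda>m. err m / p m) \<longlonglongrightarrow> 0"
      using tendsto_add[OF exp_lim[of 1] exp_lim[of "\<gamma> / 10"]] \<gamma> by (simp add: err_def add_divide_distrib)
    have "r \<longlonglongrightarrow> (0 + 2 * 0) / P0" unfolding r_def using P0 by (intro tendsto_intros 1 2) auto
    then show ?thesis by simp
  qed

  \<comment> \<open>Risk bound for large m\<close>
  moreover have "\<forall>\<^sub>F m in sequentially.
       bayes_risk (M m) m (p m) (\<nu> m) (\<lambda>i \<omega>. eb_rejects a L c1 c2 m (\<lambda>j. X m j \<omega>) i)
         \<le> real m * p m * P0 * (1 + r m)"
  proof -
    have "(\<lambda>m. (4 * b * (ln (1 / \<gamma>') * inverse ((\<psi> m)\<^sup>2) + ln (1 / p m) / (\<psi> m)\<^sup>2) + k * inverse ((\<psi> m)\<^sup>2)) / (\<eta> * (1 - d)))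
        \<longlonglongrightarrow> (4 * b * (ln (1 / \<gamma>') * 0 + C / 2) + k * 0) / (\<eta> * (1 - d))"
      using eta_range d by (intro tendsto_intros lnp inv_psi) auto
    then have ev_slope: "\<forall>\<^sub>F m in sequentially. (4 * b * (ln (1 / \<gamma>') * inverse ((\<psi> m)\<^sup>2) + ln (1 / p m) / (\<psi> m)\<^sup>2)
        + k * inverse ((\<psi> m)\<^sup>2)) / (\<eta> * (1 - d)) < Q\<^sup>2"
      using slope by (intro order_tendstoD(2)) auto
    have ev_lnm: "\<forall>\<^sub>F m in sequentially. ln (real m) / (\<psi> m)\<^sup>2 < C / (2 * \<epsilon>) + 1"
      by (rule order_tendstoD(2)[OF lnm]) simp
    have ev_ln: "\<forall>\<^sub>F m in sequentially. 1 \<le> ln (real m)" by real_asymp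
    \<comment> \<open>Puts the upper bound 5 * p for \<open>tau_hat\<close> within the ranges of
      both thresholds, T \<le> 1 and \<tau> \<le> T0.\<close>
    have ev_p: "\<forall>\<^sub>F m in sequentially. p m < min (1 / 5) (T0 / 5)"
      using T0 by (intro order_tendstoD(2)[OF p_lim]) auto
    have ev_mp: "\<forall>\<^sub>F m in sequentially. 1 \<le> real m * p m"
      using mp by (simp add: filterlim_at_top)
    show ?thesis
      using ev_slope ev_lnm ev_ln ev_p ev_mp eventually_ge_at_top[of 1]
    proof eventually_elim
      case (elim m)
      interpret tg: two_groups "M m" m "p m" "\<psi> m" "\<nu> m" "X m" by (rule model[OF elim(6)])
      have p: "0 < p m" "p m < 1" using p_range[OF elim(6)] by auto
      have psi: "(\<psi> m)\<^sup>2 > 0" by (rule psi_pos[OF elim(6)])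
      have s: "1 + (\<psi> m)\<^sup>2 > 0" using psi by linarith
      define T where "T = sqrt (c1 * ln (real m))"
      have "ln (real m) \<le> (1 + (\<psi> m)\<^sup>2) * (C / (2 * \<epsilon>) + 1)"
      proof -
        have "ln (real m) \<le> (\<psi> m)\<^sup>2 * (C / (2 * \<epsilon>) + 1)" using elim(2) psi by (simp add: field_simps)
        also have "\<dots> \<le> (1 + (\<psi> m)\<^sup>2) * (C / (2 * \<epsilon>) + 1)"
          using C_pos eps_range by (intro mult_right_mono) auto
        finally show ?thesis .
      qed
      then have "c1 * ln (real m) \<le> c1 * ((1 + (\<psi> m)\<^sup>2) * (C / (2 * \<epsilon>) + 1))"
        using c1_ge by (intro mult_left_mono) auto
      then have "T \<le> sqrt (c1 * ((1 + (\<psi> m)\<^sup>2) * (C / (2 * \<epsilon>) + 1)))"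
        unfolding T_def by (rule real_sqrt_le_mono)
      also have "\<dots> = sqrt (1 + (\<psi> m)\<^sup>2) * R"
        unfolding R_def by (simp add: mult.left_commute flip: real_sqrt_mult)
      finally have alt: "\<gamma> \<le> measure (centred_normal (1 + (\<psi> m)\<^sup>2)) {x. T < \<bar>x\<bar>}"
        unfolding \<gamma>_def using s by (rule alternative_exceedance_ge)
      have "measure (centred_normal 1) {x. T < \<bar>x\<bar>} \<le> 1 / real m"
        unfolding T_def by (rule null_exceedance_le[OF c1_ge elim(3)])
      also have "\<dots> \<le> p m" using elim(5,6) by (simp add: field_simps)
      finally have null: "measure (centred_normal 1) {x. T < \<bar>x\<bar>} \<le> p m" .
      define S where "S \<omega> = (\<Sum>j = 1..m. of_bool (\<bar>X m j \<omega>\<bar> > T) :: real)" for \<omega>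
      define G where "G = {\<omega> \<in> space (M m). \<gamma> / 2 * (real m * p m) < S \<omega> \<and> S \<omega> < 5 * (real m * p m)}"
      have G: "G \<in> tg.events" "tg.prob (space (M m) - G) \<le> err m"
        unfolding G_def S_def err_def
        by (rule tg.exceedance_count_concentration[OF elim(6) p \<gamma> null alt])+
      have \<tau>: "\<gamma>' * p m \<le> tau_hat c1 c2 m (\<lambda>j. X m j \<omega>)" "tau_hat c1 c2 m (\<lambda>j. X m j \<omega>) \<le> 5 * p m"
        if "\<omega> \<in> G" for \<omega>
      proof -
        have S: "\<gamma> / 2 * (real m * p m) < S \<omega>" "S \<omega> < 5 * (real m * p m)"
          using that by (simp_all add: G_def)
        have mp5: "1 \<le> 5 * (real m * p m)" using elim(5) by linarith
        note bounds = tau_hat_bounds[OF elim(6) c2_ge mp5 S_def[of \<omega>, unfolded T_def] S]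
        show "\<gamma>' * p m \<le> tau_hat c1 c2 m (\<lambda>j. X m j \<omega>)" "tau_hat c1 c2 m (\<lambda>j. X m j \<omega>) \<le> 5 * p m"
          unfolding \<gamma>'_def by (rule bounds)+
      qed
      have "\<theta> (5 * p m) \<le> \<bar>X m i \<omega>\<bar>"
        if "\<omega> \<in> G" "eb_rejects a L c1 c2 m (\<lambda>j. X m j \<omega>) i" for i \<omega>
      proof (rule \<theta>)
        show "0 < tau_hat c1 c2 m (\<lambda>j. X m j \<omega>)"
          using \<tau>(1)[OF that(1)] mult_pos_pos[OF \<gamma>' p(1)] by linarith
        show "5 * p m \<le> 1" using elim(4) by simp
      qed (use \<tau>(2) that in \<open>auto simp: eb_rejects_def\<close>)
      moreover have "\<bar>X m i \<omega>\<bar> \<le> sqrt (1 + (\<psi> m)\<^sup>2) * Q"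
        if "\<omega> \<in> G" "\<not> eb_rejects a L c1 c2 m (\<lambda>j. X m j \<omega>) i" for i \<omega>
      proof -
        have "(X m i \<omega>)\<^sup>2 \<le> (4 * b * ln (1 / (\<gamma>' * p m)) + k) / (\<eta> * (1 - d))"
        proof (rule accept)
          show "0 < \<gamma>' * p m" using \<gamma>' p by simp
          show "\<gamma>' * p m \<le> tau_hat c1 c2 m (\<lambda>j. X m j \<omega>)" by (rule \<tau>(1)[OF that(1)])
          show "tau_hat c1 c2 m (\<lambda>j. X m j \<omega>) \<le> T0" using \<tau>(2)[OF that(1)] elim(4) by simp
          show "1/2 \<le> kappa_posterior_mean a L (tau_hat c1 c2 m (\<lambda>j. X m j \<omega>)) (X m i \<omega>)"
            using that(2) by (simp add: eb_rejects_def)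
        qed
        also have "ln (1 / (\<gamma>' * p m)) = ln (1 / \<gamma>') + ln (1 / p m)"
          using \<gamma>' p by (simp add: ln_div ln_mult)
        \<comment> \<open>\<psi>^2 is factored out to reach the sequence whose limit lies below
          Q^2.\<close>
        also have "(4 * b * (ln (1 / \<gamma>') + ln (1 / p m)) + k) / (\<eta> * (1 - d))
           = (\<psi> m)\<^sup>2 * ((4 * b * (ln (1 / \<gamma>') * inverse ((\<psi> m)\<^sup>2) + ln (1 / p m) / (\<psi> m)\<^sup>2)
               + k * inverse ((\<psi> m)\<^sup>2)) / (\<eta> * (1 - d)))"
          using psi by (simp add: divide_inverse algebra_simps)
        also have "\<dots> \<le> (\<psi> m)\<^sup>2 * Q\<^sup>2" using elim(1) by (intro mult_left_mono) auto
        \<comment> \<open>Enlarging \<psi>^2 to the variance 1 + \<psi>^2 makes the standardised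
          threshold exactly \<open>Q\<close>.\<close>
        also have "\<dots> \<le> (1 + (\<psi> m)\<^sup>2) * Q\<^sup>2" by (intro mult_right_mono) auto
        finally have "sqrt ((X m i \<omega>)\<^sup>2) \<le> sqrt ((1 + (\<psi> m)\<^sup>2) * Q\<^sup>2)" by (rule real_sqrt_le_mono)
        then show ?thesis using Q_pos by (simp add: real_sqrt_mult)
      qed
      ultimately have "bayes_risk (M m) m (p m) (\<nu> m) (\<lambda>i \<omega>. eb_rejects a L c1 c2 m (\<lambda>j. X m j \<omega>) i)
          \<le> real m * (measure (centred_normal 1) {x. \<theta> (5 * p m) \<le> \<bar>x\<bar>}
            + p m * measure (centred_normal (1 + (\<psi> m)\<^sup>2)) {x. \<bar>x\<bar> \<le> sqrt (1 + (\<psi> m)\<^sup>2) * Q}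
            + 2 * tg.prob (space (M m) - G))"
        using p G(1) by (intro tg.bayes_risk_le) auto
      also have "\<dots> = real m * (N m + p m * P0 + 2 * tg.prob (space (M m) - G))"
        using measure_centred_normal_interval[OF s, of Q] Q_pos by (simp add: centred_normal_1 N_def P0_def)
      also have "\<dots> \<le> real m * (N m + p m * P0 + 2 * err m)"
        using G(2) by (intro mult_left_mono) auto
      also have "\<dots> = real m * p m * P0 * (1 + r m)"
        using p P0 by (simp add: r_def field_simps)
      finally show ?case .
    qed
  qed
  ultimately show ?thesis unfolding P0_def Q_def by blast
qed

end
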